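(* Every $10$-tough graph on at least three vertices is fractionally Hamiltonian.
   Context: All graphs are finite, simple and connected. For a graph $G$ and $S\subseteq V(G)$, let $c(G-S)$ be the number of connected components of $G-S$. The toughness of a noncomplete graph $G$ is $\tau(G):=\min\{|S|/c(G-S): S\subseteq V(G),\ c(G-S)>1\}$; complete graphs have infinite toughness. $G$ is $t$-tough if $\tau(G)\ge t$. For a nonempty proper set $S\subsetneq V(G)$, let $\partial(S):=\{uv\in E(G): |\{u,v\}\cap S|=1\}$. For an edge weighting $f:E(G)\to\mathbb R$ and $F\subseteq E(G)$, write $f(F):=\sum_{e\in F}f(e)$. A fractional Hamiltonian cycle of $G$ is an edge weighting $f:E(G)\to[0,1]$ such that $f(E(G))=|V(G)|$ and $f(\partial(S))\ge 2$ for every nonempty proper set $S\subsetneq V(G)$. A graph is fractionally Hamiltonian if it has a fractional Hamiltonian cycle. *)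

theory Defs
  imports Complex_Main "HOL-Library.Extended_Real"
begin

text \<open>
  A graph is given by its vertex set \<open>V\<close> and its set \<open>E\<close> of edges, an edge being the
  two-element set of its ends.
\<close>

definition fin_simple_graph :: "'a set \<Rightarrow> 'a set set \<Rightarrow> bool" where
  "fin_simple_graph V E \<longleftrightarrow> finite V \<and> (\<forall>e\<in>E. e \<subseteq> V \<and> card e = 2)"

definition reachable :: "'a set \<Rightarrow> 'a set set \<Rightarrow> ('a \<times> 'a) set" where
  "reachable V E = {(u, v). {u, v} \<in> E}\<^sup>* \<inter> V \<times> V"

definition components :: "'a set \<Rightarrow> 'a set set \<Rightarrow> 'a set set" where
  "components V E = V // reachable V E"

definition connected_graph :: "'a set \<Rightarrow> 'a set set \<Rightarrow> bool" where
  "connected_graph V E \<longleftrightarrow> V \<noteq> {} \<and> (\<forall>u\<in>V. \<forall>v\<in>V. (u, v) \<in> reachable V E)"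

definition complete_graph :: "'a set \<Rightarrow> 'a set set \<Rightarrow> bool" where
  "complete_graph V E \<longleftrightarrow> (\<forall>u\<in>V. \<forall>v\<in>V. u \<noteq> v \<longrightarrow> {u, v} \<in> E)"

text \<open>The number $c(G - S)$ of components left after deleting the vertices in \<open>S\<close>.\<close>

definition comps_after_deleting :: "'a set \<Rightarrow> 'a set set \<Rightarrow> 'a set \<Rightarrow> nat" where
  "comps_after_deleting V E S = card (components (V - S) {e \<in> E. e \<inter> S = {}})"

text \<open>
  For a noncomplete finite simple graph the minimum is over a finite nonempty set; see
  \<open>finite_toughness_ratios\<close> and \<open>toughness_ratios_nonempty\<close> below.
\<close>

definition toughness_ratios :: "'a set \<Rightarrow> 'a set set \<Rightarrow> real set" where
  "toughness_ratios V E =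
     {real (card S) / real (comps_after_deleting V E S) | S.
        S \<subseteq> V \<and> comps_after_deleting V E S > 1}"

definition toughness :: "'a set \<Rightarrow> 'a set set \<Rightarrow> ereal" where
  "toughness V E =
     (if complete_graph V E then \<infinity> else ereal (Min (toughness_ratios V E)))"

definition tough :: "real \<Rightarrow> 'a set \<Rightarrow> 'a set set \<Rightarrow> bool" where
  "tough t V E \<longleftrightarrow> toughness V E \<ge> ereal t"

definition edge_cut :: "'a set set \<Rightarrow> 'a set \<Rightarrow> 'a set set" where
  "edge_cut E S = {e \<in> E. card (e \<inter> S) = 1}"

text \<open>An edge weighting is a function on all sets of vertices; only its values on \<open>E\<close> matter.\<close>

definition fractional_Hamiltonian_cycle ::
    "'a set \<Rightarrow> 'a set set \<Rightarrow> ('a set \<Rightarrow> real) \<Rightarrow> bool" where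
  "fractional_Hamiltonian_cycle V E f \<longleftrightarrow>
     (\<forall>e\<in>E. 0 \<le> f e \<and> f e \<le> 1) \<and>
     sum f E = real (card V) \<and>
     (\<forall>S. S \<noteq> {} \<and> S \<subset> V \<longrightarrow> sum f (edge_cut E S) \<ge> 2)"

definition fractionally_Hamiltonian :: "'a set \<Rightarrow> 'a set set \<Rightarrow> bool" where
  "fractionally_Hamiltonian V E \<longleftrightarrow> (\<exists>f. fractional_Hamiltonian_cycle V E f)"

lemma finite_edges: "fin_simple_graph V E \<Longrightarrow> finite E"
  by (rule finite_subset[of _ "Pow V"]) (auto simp: fin_simple_graph_def)

lemma equiv_reachable: "equiv V (reachable V E)"
proof -
  have "sym ({(u, v). {u, v} \<in> E}\<^sup>*)"
    by (rule sym_rtrancl) (auto simp: sym_def insert_commute)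
  then show ?thesis
    unfolding reachable_def
    by (intro equivI) (auto simp: refl_on_def sym_def trans_def)
qed

lemma connected_graph_iff: "connected_graph V E \<longleftrightarrow> card (components V E) = 1"
proof
  assume c: "connected_graph V E"
  then have r: "reachable V E = V \<times> V" "V \<noteq> {}"
    by (auto simp: connected_graph_def reachable_def)
  then have "components V E = {V}"
    by (auto simp: components_def quotient_def)
  then show "card (components V E) = 1" by simp
next
  assume "card (components V E) = 1"
  then obtain C where C: "components V E = {C}"
    by (auto simp: card_1_singleton_iff)
  have "V = C"
    using Union_quotient[OF equiv_reachable, of V E] C by (simp add: components_def)
  moreover have "V \<noteq> {}"
    using C by (auto simp: components_def)
  moreover have "(u, v) \<in> reachable V E" if "u \<in> C" "v \<in> C" for u v
    using quotient_eq_iff[OF equiv_reachable, of C V E C u v] C that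
    by (simp add: components_def)
  ultimately show "connected_graph V E"
    by (auto simp: connected_graph_def)
qed

lemma finite_toughness_ratios:
  assumes "fin_simple_graph V E"
  shows "finite (toughness_ratios V E)"
  by (rule finite_subset[of _ "(\<lambda>S. real (card S) / real (comps_after_deleting V E S)) ` Pow V"])
     (use assms in \<open>auto simp: toughness_ratios_def fin_simple_graph_def\<close>)

lemma toughness_ratios_nonempty:
  assumes G: "fin_simple_graph V E" and nc: "\<not> complete_graph V E"
  shows "toughness_ratios V E \<noteq> {}"
proof -
  obtain u v where uv: "u \<in> V" "v \<in> V" "u \<noteq> v" "{u, v} \<notin> E"
    using nc by (auto simp: complete_graph_def)
  define S where "S = V - {u, v}"
  have no_edge: "{e \<in> E. e \<inter> S = {}} = {}"
  proof -
    have False if e: "e \<in> E" "e \<inter> S = {}" for e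
    proof -
      have "e \<subseteq> {u, v}" "card e = 2"
        using e G by (auto simp: S_def fin_simple_graph_def)
      then have "e = {u, v}"
        using uv(3) by (intro card_subset_eq) auto
      with e uv(4) show False by simp
    qed
    then show ?thesis by blast
  qed
  have VS: "V - S = {u, v}"
    using uv by (auto simp: S_def)
  have "components {u, v} {} = {{u}, {v}}"
    by (auto simp: components_def reachable_def quotient_def)
  then have "comps_after_deleting V E S = 2"
    using uv(3) by (simp add: comps_after_deleting_def no_edge VS)
  then show ?thesis
    unfolding toughness_ratios_def by (auto intro!: exI[of _ S] simp: S_def)
qed

end

theory Submission
  imports "HOL-Analysis.Analysis" Defs
begin

text \<open>
  By linear programming duality it suffices that a nonnegative weighting of the cuts which puts total
  weight at most 1 on the cuts through each edge has total weight at most \<open>|V| / 2\<close>. An optimal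
  such weighting can be taken cross-free, and then some vertex \<open>\<rho>\<close> has weight at least \<open>1 / 2\<close> on
  its singleton cut. Rooted at \<open>\<rho>\<close>, the cuts form a tree with edge lengths \<open>w\<close>, each vertex \<open>v\<close>
  becomes a ball of radius \<open>z v\<close> in it, adjacent vertices have intersecting balls, and the claim is
  that the length of the tree is at most the sum of the radii.

  Sweep the tree from the leaves. At time \<open>r\<close> delete all vertices of radius at least \<open>r / 4\<close> and,
  for each tree edge meeting height \<open>r\<close>, the vertices below it whose ball contains the point at
  height \<open>r / 2\<close> on the longest downward path. This separates one leaf below each such edge from
  the others and from \<open>\<rho>\<close>, so by toughness the number of deleted vertices is at least 8 times the
  number of such edges. A vertex \<open>v\<close> is deleted during a set of times of measure at most \<open>8 * z v\<close>,
  and integrating over \<open>r\<close> gives the claim.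
\<close>

section \<open>Components and toughness\<close>

lemma reachable_closed:
  assumes "(a, b) \<in> reachable U F" "a \<in> Q"
    and "\<And>u v. {u, v} \<in> F \<Longrightarrow> u \<in> Q \<Longrightarrow> v \<in> Q"
  shows "b \<in> Q"
proof -
  have "(a, b) \<in> {(u, v). {u, v} \<in> F}\<^sup>*"
    using assms(1) by (auto simp: reachable_def)
  then show ?thesis
    by (induction rule: rtrancl_induct) (use assms(2,3) in auto)
qed

lemma card_le_card_components:
  assumes "finite U" "R \<subseteq> U"
    and "\<And>a b. a \<in> R \<Longrightarrow> b \<in> R \<Longrightarrow> (a, b) \<in> reachable U F \<Longrightarrow> a = b"
  shows "card R \<le> card (components U F)"
proof (rule card_inj_on_le)
  show "inj_on (\<lambda>a. reachable U F `` {a}) R"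
  proof (rule inj_onI)
    fix a b assume ab: "a \<in> R" "b \<in> R" "reachable U F `` {a} = reachable U F `` {b}"
    then have "(a, b) \<in> reachable U F"
      using eq_equiv_class[OF ab(3) equiv_reachable] assms(2) by auto
    then show "a = b" using ab assms(3) by blast
  qed
  show "(\<lambda>a. reachable U F `` {a}) ` R \<subseteq> components U F"
    using assms(2) by (auto simp: components_def quotient_def)
  show "finite (components U F)"
    unfolding components_def
    by (rule finite_quotient[OF assms(1)]) (auto simp: reachable_def)
qed

text \<open>Excludes the infinite case of \<open>toughness\<close>: a graph that some deletion
  disconnects is not complete.\<close>

lemma comps_after_deleting_complete:
  assumes "complete_graph V E"
  shows "comps_after_deleting V E S \<le> 1"
proof -
  let ?F = "{e \<in> E. e \<inter> S = {}}"
  have "(u, v) \<in> reachable (V - S) ?F" if "u \<in> V - S" "v \<in> V - S" for u v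
  proof (cases "u = v")
    case False
    then have "(u, v) \<in> {(u, v). {u, v} \<in> ?F}"
      using assms that by (auto simp: complete_graph_def)
    then show ?thesis using that unfolding reachable_def by blast
  qed (use that in \<open>auto simp: reachable_def\<close>)
  then have r: "reachable (V - S) ?F = (V - S) \<times> (V - S)"
    by (auto simp: reachable_def)
  have "components (V - S) ?F \<subseteq> {V - S}"
    unfolding components_def quotient_def r by auto
  then have "card (components (V - S) ?F) \<le> card {V - S}"
    by (intro card_mono) auto
  then show ?thesis
    by (simp add: comps_after_deleting_def)
qed

lemma tough_bound:
  assumes "fin_simple_graph V E" "tough t V E" "S \<subseteq> V" "comps_after_deleting V E S > 1"
  shows "t * real (comps_after_deleting V E S) \<le> real (card S)"
proof -
  have nc: "\<not> complete_graph V E"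
    using comps_after_deleting_complete[of V E S] assms(4) by auto
  let ?q = "real (card S) / real (comps_after_deleting V E S)"
  have "?q \<in> toughness_ratios V E"
    using assms(3,4) by (auto simp: toughness_ratios_def)
  then have "Min (toughness_ratios V E) \<le> ?q"
    using finite_toughness_ratios[OF assms(1)] by simp
  moreover have "t \<le> Min (toughness_ratios V E)"
    using assms(2) nc by (simp add: tough_def toughness_def)
  ultimately have "t \<le> ?q" by simp
  then show ?thesis
    using assms(4) by (simp add: field_simps)
qed

section \<open>Integrals of interval indicators\<close>

lemma has_integral_indicator_Icc:
  fixes a b :: real
  assumes "a \<le> b"
  shows "(indicator {a..b} has_integral (b - a)) UNIV"
proof -
  have "((\<lambda>x. if x \<in> {a..b} then 1::real else 0) has_integral (b - a)) UNIV"
    using has_integral_const_real[of "1::real" a b] assms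
    by (subst has_integral_restrict_UNIV) simp
  also have "(\<lambda>x. if x \<in> {a..b} then 1::real else 0) = indicator {a..b}"
    by (auto simp: fun_eq_iff indicator_def)
  finally show ?thesis .
qed

lemma has_integral_indicator_Ioc:
  fixes a b :: real
  assumes "a \<le> b"
  shows "(indicator {a<..b} has_integral (b - a)) UNIV"
proof (rule has_integral_spike[OF _ _ has_integral_indicator_Icc[OF assms]])
  show "negligible {a}" by simp
  show "indicator {a<..b} x = (indicator {a..b} x :: real)" if "x \<in> UNIV - {a}" for x
    using that by (auto simp: indicator_def)
qed

section \<open>Laminar families and balls in trees\<close>

text \<open>\<open>edge_bound\<close> expresses that the balls of adjacent vertices meet;
  \<open>z_zero\<close> provides a vertex of radius 0 below every tree edge.\<close>

locale rooted_laminar =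
  fixes V :: "'a set" and E :: "'a set set" and \<rho> :: 'a and L :: "'a set set"
    and w :: "'a set \<Rightarrow> real" and z :: "'a \<Rightarrow> real"
  assumes finite_V: "finite V" and root: "\<rho> \<in> V" and z_root: "z \<rho> = 0"
    and finite_L: "finite L" and L_subset: "S \<in> L \<Longrightarrow> S \<subseteq> V - {\<rho>}"
    and laminar: "S \<in> L \<Longrightarrow> T \<in> L \<Longrightarrow> S \<subseteq> T \<or> T \<subseteq> S \<or> S \<inter> T = {}"
    and w_nonneg: "S \<in> L \<Longrightarrow> 0 \<le> w S" and z_nonneg: "0 \<le> z v"
    and z_zero: "S \<in> L \<Longrightarrow> \<exists>x\<in>S. z x = 0"
    and edge_bound: "{u, v} \<in> E \<Longrightarrow> sum w {T \<in> L. (u \<in> T) \<noteq> (v \<in> T)} \<le> z u + z v"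
begin

text \<open>\<open>L\<close> is read as a tree with root \<open>\<rho>\<close> in which the edge above \<open>S\<close> has length \<open>w S\<close>.
  The path from \<open>u\<close> to \<open>v\<close> climbs by \<open>out u v\<close> and then descends by \<open>out v u\<close>; \<open>tot v S\<close> is
  the distance from \<open>v\<close> to the upper end of the edge \<open>S\<close>.\<close>

definition out :: "'a \<Rightarrow> 'a \<Rightarrow> real" where
  "out u v = sum w {T \<in> L. u \<in> T \<and> v \<notin> T}"

definition tot :: "'a \<Rightarrow> 'a set \<Rightarrow> real" where
  "tot v S = sum w {T \<in> L. v \<in> T \<and> T \<subseteq> S}"

lemma sum_w_mono:
  assumes "A \<subseteq> B" "B \<subseteq> L"
  shows "sum w A \<le> sum w B"
  using assms w_nonneg finite_subset[OF assms(2) finite_L] by (intro sum_mono2) auto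

lemma sum_w_Un:
  assumes "A \<subseteq> B \<union> C" "B \<subseteq> L" "C \<subseteq> L"
  shows "sum w A \<le> sum w B + sum w C"
proof -
  have f: "finite B" "finite C"
    using assms(2,3)[THEN finite_subset] finite_L by auto
  have "sum w A \<le> sum w (B \<union> C)" using assms by (intro sum_w_mono) auto
  also have "\<dots> = sum w B + sum w C - sum w (B \<inter> C)" using f by (rule sum_Un)
  also have "\<dots> \<le> sum w B + sum w C"
    using sum_nonneg[of "B \<inter> C" w] assms(2) w_nonneg by auto
  finally show ?thesis .
qed

lemma sum_w_disjoint:
  assumes "B \<union> C \<subseteq> A" "B \<inter> C = {}" "A \<subseteq> L"
  shows "sum w B + sum w C \<le> sum w A"
proof -
  have f: "finite B" "finite C"
    using assms finite_subset[OF _ finite_L] by auto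
  have "sum w B + sum w C = sum w (B \<union> C)"
    using f assms by (simp add: sum.union_disjoint)
  also have "\<dots> \<le> sum w A" using assms by (intro sum_w_mono)
  finally show ?thesis .
qed

lemma out_nonneg: "0 \<le> out u v"
  unfolding out_def using w_nonneg by (intro sum_nonneg) auto

lemma out_self: "out v v = 0"
  by (simp add: out_def)

lemma edge_bound_out: "{u, v} \<in> E \<Longrightarrow> out u v + out v u \<le> z u + z v"
  unfolding out_def
  by (rule order_trans[OF sum_w_disjoint edge_bound[of u v]]) auto

text \<open>The ascent of \<open>u\<close> joins that of \<open>x\<close> below the point where the
  ascent of \<open>v\<close> does, so the path from \<open>u\<close> to \<open>v\<close> runs along
  the stretch of the ascent of \<open>x\<close> between these points.\<close>

lemma out_separated:
  assumes "out x u < out x v"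
  shows "out u x + out v x + (out x v - out x u) \<le> out u v + out v u"
proof -
  \<comment> \<open>By laminarity, sets containing \<open>u\<close> but not \<open>x\<close> lie
    inside \<open>T0\<close> and so miss \<open>v\<close>; sets containing \<open>v\<close> but not
    \<open>x\<close> are disjoint from \<open>T0\<close> and so miss \<open>u\<close>.\<close>
  obtain T0 where T0: "T0 \<in> L" "x \<in> T0" "u \<in> T0" "v \<notin> T0"
  proof (rule ccontr)
    assume "\<not> thesis"
    then have "{T \<in> L. x \<in> T \<and> v \<notin> T} \<subseteq> {T \<in> L. x \<in> T \<and> u \<notin> T}"
      using that by auto
    from sum_w_mono[OF this] assms show False
      by (auto simp: out_def)
  qed
  let ?M = "{T \<in> L. x \<in> T \<and> u \<in> T \<and> v \<notin> T}"
  have "out x v \<le> sum w ?M + out x u"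
    unfolding out_def by (rule sum_w_Un) auto
  moreover have "out u x + sum w ?M \<le> out u v"
    unfolding out_def
    by (rule sum_w_disjoint) (use laminar T0 in blast)+
  moreover have "out v x \<le> out v u"
    unfolding out_def
    by (rule sum_w_mono) (use laminar T0 in blast)+
  ultimately show ?thesis by simp
qed

lemma tot_ge: "S \<in> L \<Longrightarrow> v \<in> S \<Longrightarrow> w S \<le> tot v S"
  unfolding tot_def using sum_w_mono[of "{S}" "{T \<in> L. v \<in> T \<and> T \<subseteq> S}"] by auto

text \<open>The second summand is the same for all \<open>v\<close> in \<open>S\<close>, so vertices
  of \<open>S\<close> compare in depth below \<open>S'\<close> as they do below
  \<open>S\<close>.\<close>

lemma tot_superset:
  assumes "S \<in> L" "v \<in> S" "S \<subseteq> S'"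
  shows "tot v S' = tot v S + sum w {T \<in> L. S \<subset> T \<and> T \<subseteq> S'}"
proof -
  have "{T \<in> L. v \<in> T \<and> T \<subseteq> S'} =
      {T \<in> L. v \<in> T \<and> T \<subseteq> S} \<union> {T \<in> L. S \<subset> T \<and> T \<subseteq> S'}"
    using laminar assms by blast
  moreover have "{T \<in> L. v \<in> T \<and> T \<subseteq> S} \<inter> {T \<in> L. S \<subset> T \<and> T \<subseteq> S'} = {}" by blast
  ultimately show ?thesis
    unfolding tot_def using finite_L by (simp add: sum.union_disjoint)
qed

lemma tot_le_out: "v \<notin> S \<Longrightarrow> tot x S \<le> out x v"
  unfolding tot_def out_def by (rule sum_w_mono) auto

lemma tot_le_out_tot: "tot x S \<le> out x v + tot v S"
  unfolding tot_def out_def by (rule sum_w_Un) auto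

text \<open>Ties between deepest vertices are broken by a fixed enumeration of \<open>V\<close>, which makes the
  choices for nested sets consistent.\<close>

lemma ex_leaf:
  "\<exists>x. (\<forall>S\<in>L. x S \<in> S \<and> z (x S) = 0 \<and> (\<forall>u\<in>S. z u = 0 \<longrightarrow> tot u S \<le> tot (x S) S)) \<and>
    (\<forall>S\<in>L. \<forall>S'\<in>L. S \<subseteq> S' \<longrightarrow> x S' \<in> S \<longrightarrow> x S' = x S)"
proof -
  obtain g :: "'a \<Rightarrow> nat" where g: "inj_on g V"
    using finite_imp_inj_to_nat_seg[OF finite_V] by blast
  define M where "M S = {v \<in> S. z v = 0 \<and> (\<forall>u\<in>S. z u = 0 \<longrightarrow> tot u S \<le> tot v S)}" for S
  define x where "x S = arg_min g (\<lambda>v. v \<in> M S)" for S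
  have M_ne: "\<exists>v. v \<in> M S" if "S \<in> L" for S
  proof -
    let ?Z = "{v \<in> S. z v = 0}"
    have "finite ?Z" "?Z \<noteq> {}"
      using finite_subset[OF L_subset[OF that]] finite_V z_zero[OF that] by auto
    then have "Max ((\<lambda>u. tot u S) ` ?Z) \<in> (\<lambda>u. tot u S) ` ?Z"
      by (intro Max_in) auto
    then obtain v where v: "v \<in> ?Z" "tot v S = Max ((\<lambda>u. tot u S) ` ?Z)" by auto
    have "tot u S \<le> tot v S" if "u \<in> ?Z" for u
      unfolding v(2) using \<open>finite ?Z\<close> that by (intro Max_ge) auto
    then show ?thesis using v(1) by (auto simp: M_def)
  qed
  have x_M: "x S \<in> M S" and x_min: "\<And>v. v \<in> M S \<Longrightarrow> g (x S) \<le> g v" if S: "S \<in> L" for S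
  proof -
    obtain v where "v \<in> M S" using M_ne[OF S] ..
    from arg_min_nat_lemma[of "\<lambda>v. v \<in> M S", OF this]
    show "x S \<in> M S" "\<And>v. v \<in> M S \<Longrightarrow> g (x S) \<le> g v"
      unfolding x_def by auto
  qed
  have consistent: "x S' = x S" if S: "S \<in> L" "S' \<in> L" "S \<subseteq> S'" "x S' \<in> S" for S S'
  proof -
    have ts: "tot v S' = tot v S + sum w {T \<in> L. S \<subset> T \<and> T \<subseteq> S'}" if "v \<in> S" for v
      by (rule tot_superset[OF S(1) that S(3)])
    have max: "tot u S' \<le> tot (x S') S'" if "u \<in> S'" "z u = 0" for u
      using x_M[OF S(2)] that by (auto simp: M_def)
    have z0: "z (x S') = 0"
      using x_M[OF S(2)] by (auto simp: M_def)
    have "tot u S \<le> tot (x S') S" if "u \<in> S" "z u = 0" for u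
      using max[of u] ts[of u] ts[of "x S'"] that S by auto
    then have 1: "x S' \<in> M S"
      using z0 S(4) by (auto simp: M_def)
    have x: "tot (x S') S \<le> tot (x S) S" "x S \<in> S" "z (x S) = 0"
      using x_M[OF S(1)] 1 by (auto simp: M_def)
    then have "tot (x S') S' \<le> tot (x S) S'"
      using ts[of "x S"] ts[of "x S'"] S by auto
    then have "x S \<in> M S'"
      using x S(3) max by (force simp: M_def)
    \<comment> \<open>Each of the two choices is deepest in both sets, so minimality of
      \<open>g\<close> applies in both directions.\<close>
    from x_min[OF S(2) this] x_min[OF S(1) 1] have "g (x S) = g (x S')" by simp
    moreover have "x S \<in> V" "x S' \<in> V"
      using L_subset[OF S(1)] x(2) S(4) by blast+
    ultimately show ?thesis using inj_onD[OF g] by metis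
  qed
  have max: "x S \<in> S \<and> z (x S) = 0 \<and> (\<forall>u\<in>S. z u = 0 \<longrightarrow> tot u S \<le> tot (x S) S)" if "S \<in> L" for S
    using x_M[OF that] by (auto simp: M_def)
  show ?thesis
  proof (rule exI[of _ x], intro conjI ballI impI)
    fix S S' assume "S \<in> L" "S' \<in> L" "S \<subseteq> S'" "x S' \<in> S"
    then show "x S' = x S" by (rule consistent)
  qed (use max in auto)
qed

definition leaf :: "'a set \<Rightarrow> 'a" where
  "leaf = (SOME x. (\<forall>S\<in>L. x S \<in> S \<and> z (x S) = 0 \<and> (\<forall>u\<in>S. z u = 0 \<longrightarrow> tot u S \<le> tot (x S) S)) \<and>
    (\<forall>S\<in>L. \<forall>S'\<in>L. S \<subseteq> S' \<longrightarrow> x S' \<in> S \<longrightarrow> x S' = x S))"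

lemma
  assumes "S \<in> L"
  shows leaf_in: "leaf S \<in> S" and z_leaf: "z (leaf S) = 0"
    and tot_leaf_max: "u \<in> S \<Longrightarrow> z u = 0 \<Longrightarrow> tot u S \<le> tot (leaf S) S"
    and leaf_consistent: "S' \<in> L \<Longrightarrow> S \<subseteq> S' \<Longrightarrow> leaf S' \<in> S \<Longrightarrow> leaf S' = leaf S"
proof -
  note l = someI_ex[OF ex_leaf, folded leaf_def]
  show "leaf S \<in> S" "z (leaf S) = 0"
    using bspec[OF conjunct1[OF l] assms] by simp_all
  show "u \<in> S \<Longrightarrow> z u = 0 \<Longrightarrow> tot u S \<le> tot (leaf S) S"
    using bspec[OF conjunct1[OF l] assms] by simp
  show "S' \<in> L \<Longrightarrow> S \<subseteq> S' \<Longrightarrow> leaf S' \<in> S \<Longrightarrow> leaf S' = leaf S"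
    using bspec[OF conjunct2[OF l] assms] by blast
qed

section \<open>Heights and the sweep\<close>

definition height :: "'a set \<Rightarrow> real" where
  "height S = tot (leaf S) S"

lemma w_le_height: "S \<in> L \<Longrightarrow> w S \<le> height S"
  unfolding height_def by (simp add: tot_ge leaf_in)

text \<open>\<open>leaf S\<close> competes for being the leaf of \<open>S'\<close>, and its way to
  the top of \<open>S'\<close> traverses the edge \<open>S'\<close> in addition.\<close>

lemma height_mono:
  assumes "S \<in> L" "S' \<in> L" "S \<subset> S'"
  shows "height S \<le> height S' - w S'"
proof -
  have "w S' \<le> sum w {T \<in> L. S \<subset> T \<and> T \<subseteq> S'}"
    using sum_w_mono[of "{S'}" "{T \<in> L. S \<subset> T \<and> T \<subseteq> S'}"] assms by auto
  then have "height S + w S' \<le> tot (leaf S) S'"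
    using tot_superset[of S "leaf S" S'] assms leaf_in by (auto simp: height_def)
  also have "\<dots> \<le> height S'"
    unfolding height_def using assms leaf_in z_leaf by (intro tot_leaf_max) auto
  finally show ?thesis by simp
qed

text \<open>The tree edge \<open>S\<close> occupies the heights from \<open>height S - w S\<close>
  to \<open>height S\<close>. With the lower end excluded, nested edges that meet at an end are
  never active together.\<close>

definition active :: "real \<Rightarrow> 'a set set" where
  "active r = {S \<in> L. r \<in> {height S - w S<..height S}}"

lemma active_disjoint:
  assumes "S \<in> active r" "S' \<in> active r" "S \<noteq> S'"
  shows "S \<inter> S' = {}"
proof -
  have L: "S \<in> L" "S' \<in> L" and r: "height S - w S < r" "r \<le> height S" "height S' - w S' < r" "r \<le> height S'"
    using assms by (auto simp: active_def)
  have "\<not> S \<subset> S'" "\<not> S' \<subset> S"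
    using height_mono[OF L] height_mono[OF L(2,1)] r by linarith+
  then show ?thesis using laminar[OF L] assms(3) by blast
qed

text \<open>The cut point of an active \<open>S\<close> at time \<open>r\<close> is the point at height \<open>r / 2\<close> on the path from
  \<open>leaf S\<close> to the root; \<open>hit r S v\<close> says that the ball of radius \<open>z v\<close> around \<open>v\<close> contains it.\<close>

definition hit :: "real \<Rightarrow> 'a set \<Rightarrow> 'a \<Rightarrow> bool" where
  "hit r S v \<longleftrightarrow> v \<in> S \<and> out v (leaf S) + \<bar>out (leaf S) v - r / 2\<bar> \<le> z v"

definition deleted :: "real \<Rightarrow> 'a set" where
  "deleted r = {v \<in> V. r \<le> 4 * z v \<or> (\<exists>S\<in>active r. hit r S v)}"

text \<open>The path from \<open>u\<close> to \<open>v\<close> passes through the cut point of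
  \<open>S\<close>, and the two balls together cover the length of this path, so one of them
  contains the cut point.\<close>

lemma cut_deleted:
  assumes r: "r > 0" and S: "S \<in> active r" and uv: "{u, v} \<in> E" "u \<in> V" "v \<in> V"
    and u: "out (leaf S) u < r / 2" and v: "r / 2 \<le> out (leaf S) v"
  shows "u \<in> deleted r \<or> v \<in> deleted r"
proof -
  let ?x = "leaf S"
  have SL: "S \<in> L" "r \<le> height S" using S by (auto simp: active_def)
  have far: "r \<le> out ?x y" if "y \<notin> S" for y
    using tot_le_out[OF that, of ?x] SL by (simp add: height_def)
  have uS: "u \<in> S"
    using far[of u] u r by auto
  have "out u ?x + (r / 2 - out ?x u) + (out v ?x + (out ?x v - r / 2)) \<le> z u + z v"
    using out_separated[of ?x u v] edge_bound_out[OF uv(1)] u v by simp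
  then consider "out u ?x + (r / 2 - out ?x u) \<le> z u" | "out v ?x + (out ?x v - r / 2) \<le> z v"
    by linarith
  then show ?thesis
  proof cases
    case 1
    then have "hit r S u" using uS u by (simp add: hit_def)
    then show ?thesis using S uv by (auto simp: deleted_def)
  next
    case 2
    show ?thesis
    proof (cases "v \<in> S")
      case True
      then have "hit r S v" using 2 v by (simp add: hit_def)
      then show ?thesis using S uv by (auto simp: deleted_def)
    next
      case False
      \<comment> \<open>Outside \<open>S\<close> there is no hit, but such a vertex is at distance
        at least \<open>r / 2\<close> from the cut point, so its radius alone causes its
        deletion.\<close>
      then have "r \<le> 4 * z v"
        using far[of v] 2 out_nonneg[of v ?x] r by simp
      then show ?thesis using uv by (auto simp: deleted_def)
    qed
  qed
qed

text \<open>The leaves of the active sets and the root survive in pairwise different components. The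
  root accounts for the \<open>+ 1\<close>, so a single active set already makes the toughness
  condition applicable.\<close>

lemma card_active_le:
  assumes G: "fin_simple_graph V E" and r: "r > 0"
  shows "card (active r) + 1 \<le> comps_after_deleting V E (deleted r)"
proof -
  let ?F = "{e \<in> E. e \<inter> deleted r = {}}"
  let ?R = "insert \<rho> (leaf ` active r)"
  have AL: "active r \<subseteq> L" by (auto simp: active_def)
  have fin: "finite (active r)" using AL finite_L finite_subset by blast
  have leaf_S: "leaf S \<in> S" "S \<subseteq> V - {\<rho>}" "z (leaf S) = 0" if "S \<in> active r" for S
    using that AL leaf_in[of S] L_subset[of S] z_leaf[of S] by auto
  have inj: "inj_on leaf (active r)"
  proof (rule inj_onI)
    fix S S' assume "S \<in> active r" "S' \<in> active r" "leaf S = leaf S'"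
    then show "S = S'"
      using active_disjoint[of S r S'] leaf_S(1)[of S] leaf_S(1)[of S'] by auto
  qed
  have "\<rho> \<notin> leaf ` active r"
    using leaf_S by blast
  then have card_R: "card ?R = card (active r) + 1"
    using fin inj by (simp add: card_image)
  have leaf_V: "leaf S \<in> V" if "S \<in> active r" for S
    using leaf_S[OF that] by blast
  have R_sub: "?R \<subseteq> V - deleted r"
  proof -
    \<comment> \<open>A vertex of radius 0 could only be hit at its own position, while the cut
      point of its own set is at distance \<open>r / 2\<close> from it.\<close>
    have "y \<notin> deleted r" if y: "z y = 0" "\<And>S. S \<in> active r \<Longrightarrow> y \<in> S \<Longrightarrow> y = leaf S" for y
    proof
      assume "y \<in> deleted r"
      then obtain S where "S \<in> active r" "hit r S y"
        using y r by (auto simp: deleted_def)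
      then have "y = leaf S" "out y (leaf S) + \<bar>out (leaf S) y - r / 2\<bar> \<le> 0"
        using y by (auto simp: hit_def)
      then show False using r by (simp add: out_self)
    qed
    moreover have "leaf S = leaf S'"
      if "S \<in> active r" "S' \<in> active r" "leaf S \<in> S'" for S S'
      using active_disjoint[OF that(1,2)] leaf_S[OF that(1)] that(3) by blast
    moreover have "\<rho> \<notin> S" if "S \<in> active r" for S
      using leaf_S[OF that] by blast
    ultimately have "\<rho> \<notin> deleted r" "\<And>S. S \<in> active r \<Longrightarrow> leaf S \<notin> deleted r"
      using z_root leaf_S(3) by metis+
    then show ?thesis using root leaf_V by blast
  qed
  have sep: "b \<in> S" if S: "S \<in> active r" and reach: "(leaf S, b) \<in> reachable (V - deleted r) ?F" for S b
  proof -
    \<comment> \<open>By \<open>cut_deleted\<close> no surviving edge passes the cut point, whereas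
      leaving \<open>S\<close> from its leaf requires a climb of at least \<open>r\<close>.\<close>
    have "b \<in> {v. out (leaf S) v < r / 2}"
    proof (rule reachable_closed[OF reach])
      show "leaf S \<in> {v. out (leaf S) v < r / 2}" using r by (simp add: out_self)
    next
      fix u v assume e: "{u, v} \<in> ?F" "u \<in> {v. out (leaf S) v < r / 2}"
      then have "u \<in> V" "v \<in> V" "u \<notin> deleted r" "v \<notin> deleted r"
        using G by (auto simp: fin_simple_graph_def)
      then show "v \<in> {v. out (leaf S) v < r / 2}"
        using cut_deleted[OF r S, of u v] e by force
    qed
    then have "out (leaf S) b < r" using r by simp
    moreover have "r \<le> tot (leaf S) S" using S by (simp add: active_def height_def)
    ultimately show ?thesis
      using tot_le_out[of b S "leaf S"] by linarith
  qed
  have sym: "(b, a) \<in> reachable (V - deleted r) ?F" if "(a, b) \<in> reachable (V - deleted r) ?F" for a b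
    by (rule symD[OF _ that]) (use equiv_reachable in \<open>auto simp: equiv_def\<close>)
  have leaf_sep: "leaf S = b" if "S \<in> active r" "b \<in> ?R" "(leaf S, b) \<in> reachable (V - deleted r) ?F" for S b
  proof -
    have "b \<in> S" by (rule sep[OF that(1,3)])
    then have "b \<noteq> \<rho>" using leaf_S[OF that(1)] by blast
    with that(2) obtain S' where S': "S' \<in> active r" "b = leaf S'" by auto
    then have "S' = S"
      using active_disjoint[OF that(1) S'(1)] \<open>b \<in> S\<close> leaf_S(1)[OF S'(1)] by blast
    with S' show ?thesis by simp
  qed
  have "card ?R \<le> card (components (V - deleted r) ?F)"
  proof (rule card_le_card_components)
    fix a b assume "a \<in> ?R" "b \<in> ?R" "(a, b) \<in> reachable (V - deleted r) ?F"
    then show "a = b"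
      using leaf_sep[of _ b] leaf_sep[of _ a, OF _ _ sym] by (elim insertE imageE) auto
  qed (use finite_V R_sub in auto)
  then show ?thesis
    by (simp add: comps_after_deleting_def card_R)
qed

text \<open>If the leaves differ, \<open>leaf S2\<close> lies outside \<open>S1\<close>, so a ball
  that hits for \<open>S2\<close> has radius at least the distance from \<open>v\<close> to the top
  of \<open>S1\<close>. Its distance to the cut point of \<open>S1\<close> is also at most
  \<open>z v\<close>, hence \<open>r1 \<le> height S1 \<le> r1 / 2 + 2 * z v\<close>. This is the
  origin of the threshold \<open>4 * z v\<close>.\<close>

lemma leaf_unique:
  assumes S: "S1 \<in> active r1" "S2 \<in> active r2" and hit: "hit r1 S1 v" "hit r2 S2 v"
    and r: "4 * z v < r1" and sub: "S1 \<subseteq> S2"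
  shows "leaf S2 = leaf S1"
proof (rule ccontr)
  assume neq: "leaf S2 \<noteq> leaf S1"
  have L: "S1 \<in> L" "S2 \<in> L" "r1 \<le> height S1" using S by (auto simp: active_def)
  have "leaf S2 \<notin> S1" using leaf_consistent L sub neq by blast
  then have "tot v S1 \<le> out v (leaf S2)" by (rule tot_le_out)
  also have "\<dots> \<le> z v" using hit(2) by (auto simp: hit_def)
  finally have "tot v S1 \<le> z v" .
  moreover have "height S1 \<le> out (leaf S1) v + tot v S1"
    unfolding height_def by (rule tot_le_out_tot)
  moreover have "\<bar>out (leaf S1) v - r1 / 2\<bar> \<le> z v"
    using hit(1) out_nonneg[of v "leaf S1"] by (simp add: hit_def)
  ultimately show False using L r by linarith
qed

text \<open>By \<open>leaf_unique\<close>, after time \<open>4 * z v\<close> the vertex \<open>v\<close> is hit only on the path of one leaf,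
  along which the cut point moves at speed \<open>1 / 2\<close>.\<close>

lemma deleted_times:
  "\<exists>c. \<forall>r. v \<in> deleted r \<longrightarrow> r \<le> 4 * z v \<or> r \<in> {c - 2 * z v..c + 2 * z v}"
proof (cases "\<exists>r S. 4 * z v < r \<and> S \<in> active r \<and> hit r S v")
  case True
  then obtain r S where rS: "4 * z v < r" "S \<in> active r" "hit r S v" by blast
  have "r' \<in> {2 * out (leaf S) v - 2 * z v..2 * out (leaf S) v + 2 * z v}"
    if r': "4 * z v < r'" "S' \<in> active r'" "hit r' S' v" for r' S'
  proof -
    have "v \<in> S" "v \<in> S'" "S \<in> L" "S' \<in> L"
      using rS r' by (auto simp: hit_def active_def)
    then have "S \<subseteq> S' \<or> S' \<subseteq> S" using laminar by blast
    then have "leaf S' = leaf S"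
      using leaf_unique rS r' by metis
    then have "\<bar>out (leaf S) v - r' / 2\<bar> \<le> z v"
      using r'(3) out_nonneg[of v "leaf S'"] by (simp add: hit_def)
    then show ?thesis by (simp add: abs_le_iff field_simps)
  qed
  then show ?thesis
    by (intro exI[of _ "2 * out (leaf S) v"]) (force simp: deleted_def)
next
  case False
  then show ?thesis by (force simp: deleted_def)
qed

text \<open>Counting in two ways: \<open>f\<close> is 8 times the number of active sets and
  integrates to \<open>8 * sum w L\<close>; \<open>g\<close> bounds the number of deleted vertices,
  each vertex contributing two intervals of length \<open>4 * z v\<close>.\<close>

lemma sum_weights_le:
  assumes G: "fin_simple_graph V E"
    and tough: "\<And>X. X \<subseteq> V \<Longrightarrow> comps_after_deleting V E X > 1 \<Longrightarrow>
      8 * real (comps_after_deleting V E X) \<le> real (card X)"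
  shows "sum w L \<le> sum z V"
proof -
  obtain c where c: "\<And>v r. v \<in> deleted r \<Longrightarrow> r \<le> 4 * z v \<or> r \<in> {c v - 2 * z v..c v + 2 * z v}"
    using deleted_times by metis
  define f :: "real \<Rightarrow> real" where
    "f r = (\<Sum>S\<in>L. 8 * indicator {height S - w S<..height S} r)" for r
  define g :: "real \<Rightarrow> real" where
    "g r = (\<Sum>v\<in>V. indicator {0..4 * z v} r + indicator {c v - 2 * z v..c v + 2 * z v} r)" for r
  have "(f has_integral (\<Sum>S\<in>L. 8 * (height S - (height S - w S)))) UNIV"
    unfolding f_def using finite_L w_nonneg
    by (intro has_integral_sum has_integral_mult_right has_integral_indicator_Ioc) auto
  moreover have "(g has_integral (\<Sum>v\<in>V. (4 * z v - 0) + ((c v + 2 * z v) - (c v - 2 * z v)))) UNIV"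
    unfolding g_def using finite_V z_nonneg
    by (intro has_integral_sum has_integral_add has_integral_indicator_Icc) auto
  moreover have "f r \<le> g r" for r
  proof (cases "active r = {}")
    case True
    then have "f r = 0"
      unfolding f_def by (intro sum.neutral) (auto simp: active_def indicator_def)
    moreover have "0 \<le> g r" unfolding g_def by (intro sum_nonneg) auto
    ultimately show ?thesis by simp
  next
    case False
    \<comment> \<open>Activity starts after \<open>height S - w S\<close>, which is not
      negative.\<close>
    then have r: "r > 0" using w_le_height by (force simp: active_def)
    have fin: "finite (active r)" using finite_L by (auto simp: active_def)
    let ?k = "comps_after_deleting V E (deleted r)"
    have k: "card (active r) + 1 \<le> ?k" by (rule card_active_le[OF G r])
    have "card (active r) > 0" using False fin by (simp add: card_gt_0_iff)
    then have "8 * real ?k \<le> real (card (deleted r))"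
      using k by (intro tough) (auto simp: deleted_def)
    moreover have "f r = 8 * real (card (active r))"
    proof -
      have "f r = (\<Sum>S\<in>active r. 8)"
        unfolding f_def using finite_L
        by (intro sum.mono_neutral_cong_right) (auto simp: active_def indicator_def)
      then show ?thesis by simp
    qed
    moreover have "real (card (deleted r)) \<le> g r"
    proof -
      have "real (card (deleted r)) = (\<Sum>v\<in>deleted r. 1)" by simp
      also have "\<dots> \<le> (\<Sum>v\<in>deleted r. indicator {0..4 * z v} r + indicator {c v - 2 * z v..c v + 2 * z v} r)"
        using c r by (intro sum_mono) (fastforce simp: indicator_def)
      also have "\<dots> \<le> g r"
        unfolding g_def using finite_V by (intro sum_mono2) (auto simp: deleted_def)
      finally show ?thesis .
    qed
    ultimately show ?thesis using k by linarith
  qed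
  ultimately have "(\<Sum>S\<in>L. 8 * (height S - (height S - w S))) \<le>
      (\<Sum>v\<in>V. (4 * z v - 0) + ((c v + 2 * z v) - (c v - 2 * z v)))"
    using has_integral_le by blast
  then have "8 * sum w L \<le> 8 * sum z V"
    by (simp add: sum_distrib_left)
  then show ?thesis by simp
qed

end

section \<open>Farkas' lemma\<close>

text \<open>Closure rules in place of explicit finite combinations, so that multipliers can be
  extracted by rule induction.\<close>

inductive_set conic_hull_pairs :: "(('j \<Rightarrow> real) \<times> real) set \<Rightarrow> (('j \<Rightarrow> real) \<times> real) set"
  for C where
  conic_base: "c \<in> C \<Longrightarrow> c \<in> conic_hull_pairs C"
| conic_add: "(a, b) \<in> conic_hull_pairs C \<Longrightarrow> (a', b') \<in> conic_hull_pairs C \<Longrightarrow> (\<lambda>j. a j + a' j, b + b') \<in> conic_hull_pairs C"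
| conic_scale: "(a, b) \<in> conic_hull_pairs C \<Longrightarrow> 0 \<le> t \<Longrightarrow> (\<lambda>j. t * a j, t * b) \<in> conic_hull_pairs C"

lemma conic_subset:
  assumes "C' \<subseteq> conic_hull_pairs C"
  shows "conic_hull_pairs C' \<subseteq> conic_hull_pairs C"
proof
  show "c \<in> conic_hull_pairs C" if "c \<in> conic_hull_pairs C'" for c
    using that by induction (use assms in \<open>auto intro: conic_add conic_scale\<close>)
qed

text \<open>Yields the value of an eliminated variable from its lower bounds \<open>A\<close> and
  upper bounds \<open>B\<close>.\<close>

lemma ex_between:
  fixes A B :: "real set"
  assumes "finite A" "finite B" "\<And>a b. a \<in> A \<Longrightarrow> b \<in> B \<Longrightarrow> a \<le> b"
  shows "\<exists>t. (\<forall>a\<in>A. a \<le> t) \<and> (\<forall>b\<in>B. t \<le> b)"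
proof (cases "A = {}")
  case True
  show ?thesis
    using assms(2) True by (intro exI[of _ "if B = {} then 0 else Min B"]) auto
next
  case False
  then show ?thesis
    using assms by (intro exI[of _ "Max A"]) auto
qed

text \<open>Farkas' lemma by Fourier--Motzkin elimination; a pair \<open>(a, b)\<close> encodes the
  inequality \<open>a \<bullet> x \<ge> b\<close>.\<close>

lemma farkas:
  assumes "finite J" "finite C"
    and "\<And>x. \<exists>(a, b)\<in>C. (\<Sum>j\<in>J. a j * x j) < b"
  shows "\<exists>(a, b)\<in>conic_hull_pairs C. (\<forall>j\<in>J. a j = 0) \<and> 0 < b"
  using assms
proof (induction J arbitrary: C rule: finite_induct)
  case empty
  then show ?case by (auto intro: conic_base)
next
  case (insert k J)
  \<comment> \<open>The combination of a pair from \<open>P\<close> with one from \<open>N\<close>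
    in which the coefficients of \<open>k\<close> cancel; both multipliers are positive
    there.\<close>
  define comb where "comb = (\<lambda>((a, b), (a', b')).
    (\<lambda>j. a k * a' j + (- a' k) * a j, a k * b' + (- a' k) * b :: real))"
  define Z P N where "Z = {c \<in> C. fst c k = 0}" and "P = {c \<in> C. 0 < fst c k}"
    and "N = {c \<in> C. fst c k < 0}"
  define C' where "C' = Z \<union> comb ` (P \<times> N)"
  have fin: "finite P" "finite N" "finite C'"
    using insert.prems(1) by (auto simp: C'_def Z_def P_def N_def)
  have infeasible: "\<exists>(a, b)\<in>C'. (\<Sum>j\<in>J. a j * x j) < b" for x
  proof (rule ccontr)
    assume "\<not> ?thesis"
    then have feas: "b \<le> (\<Sum>j\<in>J. a j * x j)" if "(a, b) \<in> C'" for a b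
      using that by force
    define s where "s a = (\<Sum>j\<in>J. a j * x j)" for a
    \<comment> \<open>The bound that an inequality puts on variable \<open>k\<close> once the others
      are fixed: a lower bound for \<open>P\<close>, an upper bound for \<open>N\<close>.\<close>
    define q where "q = (\<lambda>(a, b). (b - s a) / a k)"
    have "q c \<le> q c'" if "c \<in> P" "c' \<in> N" for c c'
    proof -
      obtain a b a' b' where c: "c = (a, b)" "c' = (a', b')" by fastforce
      have pos: "0 < a k" "a' k < 0" using that by (auto simp: P_def N_def c)
      have "comb (c, c') \<in> C'" using that by (auto simp: C'_def)
      then have "a k * b' + (- a' k) * b \<le> s (\<lambda>j. a k * a' j + (- a' k) * a j)"
        unfolding c s_def comb_def by (intro feas) simp
      also have "\<dots> = a k * s a' + (- a' k) * s a"
        by (simp add: s_def sum_distrib_left sum.distrib sum_subtractf sum_negf algebra_simps)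
      finally have "(- a' k) * (b - s a) \<le> a k * (s a' - b')"
        by (simp add: algebra_simps)
      then have "(b - s a) / a k \<le> (s a' - b') / (- a' k)"
        using pos by (simp add: field_simps)
      also have "\<dots> = (b' - s a') / a' k"
        using pos by (simp add: field_simps)
      finally show ?thesis by (simp add: q_def c)
    qed
    then have "\<exists>t. (\<forall>a\<in>q ` P. a \<le> t) \<and> (\<forall>b\<in>q ` N. t \<le> b)"
      using fin by (intro ex_between) blast+
    then obtain t where t: "\<forall>c\<in>P. q c \<le> t" "\<forall>c\<in>N. t \<le> q c"
      by blast
    have "b \<le> (\<Sum>j\<in>insert k J. a j * (x(k := t)) j)" if ab: "(a, b) \<in> C" for a b
    proof -
      have "(\<Sum>j\<in>insert k J. a j * (x(k := t)) j) = a k * t + s a"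
        unfolding s_def using insert.hyps by (auto intro!: sum.cong)
      moreover have "b - s a \<le> a k * t"
      proof (cases "a k" "0 :: real" rule: linorder_cases)
        case less
        then have "t \<le> (b - s a) / a k" using t(2) ab by (force simp: N_def q_def)
        then show ?thesis using less by (simp add: field_simps)
      next
        case equal
        then have "b \<le> s a" unfolding s_def using ab by (intro feas) (auto simp: C'_def Z_def)
        then show ?thesis using equal by simp
      next
        case greater
        then have "(b - s a) / a k \<le> t" using t(1) ab by (force simp: P_def q_def)
        then show ?thesis using greater by (simp add: field_simps)
      qed
      ultimately show ?thesis by simp
    qed
    then show False
      using insert.prems(2)[of "x(k := t)"] by fastforce
  qed
  obtain a b where ab: "(a, b) \<in> conic_hull_pairs C'" "\<forall>j\<in>J. a j = 0" "0 < b"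
    using insert.IH[OF fin(3) infeasible] by blast
  have k0: "fst c k = 0" if "c \<in> conic_hull_pairs C'" for c
    using that
  proof induction
    case (conic_base c)
    then show ?case by (auto simp: C'_def Z_def comb_def)
  qed auto
  have "C' \<subseteq> conic_hull_pairs C"
  proof -
    have "comb (c, c') \<in> conic_hull_pairs C" if "c \<in> P" "c' \<in> N" for c c'
    proof -
      obtain a b a' b' where c: "c = (a, b)" "c' = (a', b')" by fastforce
      have in_conic: "(a, b) \<in> conic_hull_pairs C" "(a', b') \<in> conic_hull_pairs C" and pos: "0 \<le> a k" "0 \<le> - a' k"
        using that unfolding c by (auto simp: P_def N_def intro: conic_base)
      from conic_add[OF conic_scale[OF in_conic(2) pos(1)] conic_scale[OF in_conic(1) pos(2)]]
      show ?thesis by (simp add: comb_def c)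
    qed
    then show ?thesis by (auto simp: C'_def Z_def intro: conic_base)
  qed
  then have "(a, b) \<in> conic_hull_pairs C"
    using ab(1) conic_subset by blast
  then show ?case
    using ab k0[OF ab(1)] by (intro bexI[of _ "(a, b)"]) auto
qed

section \<open>Packings of cuts\<close>

definition crosses :: "'a set \<Rightarrow> 'a set \<Rightarrow> real" where
  "crosses e S = of_bool (card (e \<inter> S) = 1)"

lemma crosses_doubleton: "u \<noteq> v \<Longrightarrow> crosses {u, v} S = of_bool ((u \<in> S) \<noteq> (v \<in> S))"
  by (cases "u \<in> S"; cases "v \<in> S") (simp_all add: crosses_def)

lemma crosses_nonneg: "0 \<le> crosses e S"
  by (simp add: crosses_def)

lemma sum_of_bool_mem:
  assumes "finite A" "u \<noteq> v"
  shows "(\<Sum>x\<in>A. of_bool (x = u \<or> x = v) * f x :: real) =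
    (if u \<in> A then f u else 0) + (if v \<in> A then f v else 0)"
proof -
  have "(\<Sum>x\<in>A. of_bool (x = u \<or> x = v) * f x) =
      (\<Sum>x\<in>A. if x = u then f u else 0) + (\<Sum>x\<in>A. if x = v then f v else 0)"
    unfolding sum.distrib[symmetric] using assms(2) by (intro sum.cong) auto
  then show ?thesis using assms(1) by simp
qed

locale connected_graph_3 =
  fixes V :: "'a set" and E :: "'a set set"
  assumes graph: "fin_simple_graph V E" and connected: "connected_graph V E"
    and card_V: "3 \<le> card V"
begin

definition cuts :: "'a set set" where
  "cuts = {S. S \<noteq> {} \<and> S \<subset> V}"

definition val :: "('a set \<Rightarrow> real) \<Rightarrow> ('a set \<Rightarrow> real) \<Rightarrow> real" where
  "val c y = (\<Sum>X\<in>cuts. c X * y X)"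

definition packing :: "('a set \<Rightarrow> real) \<Rightarrow> bool" where
  "packing y \<longleftrightarrow> (\<forall>S. 0 \<le> y S) \<and> (\<forall>e\<in>E. val (crosses e) y \<le> 1)"

lemma finite_V: "finite V"
  using graph by (simp add: fin_simple_graph_def)

lemma finite_cuts: "finite cuts"
  unfolding cuts_def using finite_V by (auto intro: finite_subset[of _ "Pow V"])

lemma edgeE:
  assumes "e \<in> E"
  obtains u v where "e = {u, v}" "u \<noteq> v" "u \<in> V" "v \<in> V"
proof -
  have "card e = 2" "e \<subseteq> V" using assms graph by (auto simp: fin_simple_graph_def)
  then show thesis using that by (auto simp: card_2_iff)
qed

lemma cuts_compl: "S \<in> cuts \<Longrightarrow> V - S \<in> cuts"
  by (auto simp: cuts_def)

lemma crosses_compl: "e \<in> E \<Longrightarrow> crosses e (V - S) = crosses e S"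
  by (elim edgeE) (auto simp: crosses_doubleton)

lemma ex_crossing_edge:
  assumes "S \<in> cuts"
  shows "\<exists>e\<in>E. crosses e S = 1"
proof (rule ccontr)
  assume "\<not> ?thesis"
  then have no: "crosses e S \<noteq> 1" if "e \<in> E" for e
    using that by blast
  obtain a b where ab: "a \<in> S" "b \<in> V - S" "a \<in> V"
    using assms by (auto simp: cuts_def)
  then have "(a, b) \<in> reachable V E"
    using connected by (auto simp: connected_graph_def)
  then have "b \<in> S"
  proof (rule reachable_closed)
    fix u v assume uv: "{u, v} \<in> E" "u \<in> S"
    then have "u \<noteq> v" by (auto elim!: edgeE simp: doubleton_eq_iff)
    with no[OF uv(1)] uv(2) show "v \<in> S" by (simp add: crosses_doubleton)
  qed (use ab in simp)
  with ab show False by simp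
qed

text \<open>Connectedness supplies an edge across \<open>S\<close>, whose capacity bounds the weight
  of \<open>S\<close>. This makes the search for a maximum compact.\<close>

lemma packing_le_1:
  assumes "packing y" "S \<in> cuts"
  shows "y S \<le> 1"
proof -
  obtain e where e: "e \<in> E" "crosses e S = 1"
    using ex_crossing_edge[OF assms(2)] by blast
  have "crosses e S * y S \<le> val (crosses e) y"
    unfolding val_def using assms finite_cuts
    by (intro member_le_sum) (auto simp: packing_def crosses_nonneg)
  with e assms(1) show ?thesis by (force simp: packing_def)
qed

text \<open>A continuous function is maximised over a closed subset of a product of unit intervals,
  which is compact by Tychonoff's theorem.\<close>

lemma ex_max_packing:
  "\<exists>y. packing y \<and> (\<forall>y'. packing y' \<longrightarrow> val c y' \<le> val c y)"
proof -
  let ?B = "{y :: 'a set \<Rightarrow> real. \<forall>S. y S \<in> {0..1::real}}"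
  define K where "K = ?B \<inter> (\<Inter>e\<in>E. {y. val (crosses e) y \<le> 1})"
  have cont: "continuous_on UNIV (val d)" for d
    unfolding val_def by (intro continuous_intros continuous_on_product_coordinates)
  have "compactin (product_topology (\<lambda>_. euclidean) (UNIV :: 'a set set)) (PiE UNIV (\<lambda>_. {0..1::real}))"
    by (simp add: compactin_PiE)
  moreover have "PiE (UNIV :: 'a set set) (\<lambda>_. {0..1::real}) = ?B"
    by (auto simp: PiE_def Pi_def)
  ultimately have "compact ?B"
    by (simp only: euclidean_product_topology compactin_euclidean_iff)
  moreover have "closed (\<Inter>e\<in>E. {y. val (crosses e) y \<le> 1})"
    by (intro closed_INT ballI closed_Collect_le cont continuous_on_const)
  ultimately have "compact K"
    unfolding K_def by (rule compact_Int_closed)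
  moreover have "(\<lambda>_. 0) \<in> K"
    by (simp add: K_def val_def)
  ultimately obtain y where y: "y \<in> K" "\<And>y'. y' \<in> K \<Longrightarrow> val c y' \<le> val c y"
    using continuous_attains_sup[of K "val c"] continuous_on_subset[OF cont] by blast
  have "val c y' \<le> val c y" if "packing y'" for y'
  proof -
    \<comment> \<open>Weights outside \<open>cuts\<close> may exceed 1; setting them to 0 changes no
      value of \<open>val\<close> and moves the packing into \<open>K\<close>.\<close>
    define y'' where "y'' S = (if S \<in> cuts then y' S else 0)" for S
    have eq: "val d y'' = val d y'" for d
      unfolding val_def y''_def by (intro sum.cong) auto
    have "y'' \<in> K"
      using that packing_le_1[OF that] by (auto simp: K_def eq) (auto simp: y''_def packing_def)
    from y(2)[OF this] show ?thesis by (simp add: eq)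
  qed
  moreover have "packing y" using y(1) by (auto simp: K_def packing_def)
  ultimately show ?thesis by blast
qed

lemma val_add: "val c (\<lambda>X. y X + t * d X) = val c y + t * val c d"
  by (simp add: val_def sum.distrib sum_distrib_left algebra_simps)

lemma val_plus: "val c (\<lambda>X. y X + d X) = val c y + val c d"
  by (simp add: val_def sum.distrib algebra_simps)

lemma val_minus: "val c (\<lambda>X. y X - d X) = val c y - val c d"
  by (simp add: val_def sum_subtractf algebra_simps)

lemma val_single: "S \<in> cuts \<Longrightarrow> val c (\<lambda>X. of_bool (X = S)) = c S"
  unfolding val_def using finite_cuts by (simp add: of_bool_def if_distrib cong: if_cong)

lemma val_mono: "(\<And>X. X \<in> cuts \<Longrightarrow> c X * y X \<le> d X * y' X) \<Longrightarrow> val c y \<le> val d y'"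
  unfolding val_def by (rule sum_mono)

section \<open>Perturbed optima and uncrossing\<close>

definition sz :: "'a set \<Rightarrow> real" where
  "sz S = real (card S) * (real (card V) - real (card S))"

lemma sz_nonneg: "S \<subseteq> V \<Longrightarrow> 0 \<le> sz S"
  using card_mono[OF finite_V] by (simp add: sz_def)

text \<open>\<open>sz S\<close> counts the pairs of vertices separated by \<open>S\<close>. The
  linear parts of the two sides cancel, and the quadratic ones differ by twice the product of the
  sizes of \<open>S - T\<close> and \<open>T - S\<close>.\<close>

lemma sz_submodular:
  assumes "S \<subseteq> V" "T \<subseteq> V" "\<not> S \<subseteq> T" "\<not> T \<subseteq> S"
  shows "sz (S \<inter> T) + sz (S \<union> T) < sz S + sz T"
proof -
  define p q i j where "p = real (card S)" and "q = real (card T)"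
    and "i = real (card (S \<inter> T))" and "j = real (card (S \<union> T))"
  have fin: "finite S" "finite T" using assms finite_V finite_subset by blast+
  have "p + q = i + j"
    using card_Un_Int[OF fin] by (simp add: p_def q_def i_def j_def)
  then have j: "j = p + q - i" by simp
  have "i < p" "i < q"
    using assms fin psubset_card_mono[of S "S \<inter> T"] psubset_card_mono[of T "S \<inter> T"]
    by (auto simp: i_def p_def q_def)
  then have "0 < (p - i) * (q - i)" by simp
  then show ?thesis
    unfolding sz_def p_def[symmetric] q_def[symmetric] i_def[symmetric] j_def[symmetric] j
    by (simp add: algebra_simps)
qed

text \<open>The penalty is strictly submodular, so maximisers cannot contain crossing cuts.\<close>

definition cost :: "real \<Rightarrow> 'a set \<Rightarrow> real" where
  "cost \<epsilon> S = 1 - \<epsilon> * sz S"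

definition optimal :: "real \<Rightarrow> ('a set \<Rightarrow> real) \<Rightarrow> bool" where
  "optimal \<epsilon> y \<longleftrightarrow> packing y \<and> (\<forall>y'. packing y' \<longrightarrow> val (cost \<epsilon>) y' \<le> val (cost \<epsilon>) y)"

text \<open>Shifting weight from crossing \<open>S\<close> and \<open>T\<close> to their
  intersection and union increases the load of no edge but strictly decreases the penalty.\<close>

lemma optimal_uncrossed:
  assumes opt: "optimal \<epsilon> y" and \<epsilon>: "0 < \<epsilon>"
    and ST: "S \<in> cuts" "T \<in> cuts" "0 < y S" "0 < y T"
  shows "S \<subseteq> T \<or> T \<subseteq> S \<or> S \<inter> T = {} \<or> S \<union> T = V"
proof (rule ccontr)
  assume cross: "\<not> ?thesis"
  have IU: "S \<inter> T \<in> cuts" "S \<union> T \<in> cuts"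
    using ST(1,2) cross by (auto simp: cuts_def)
  define t where "t = min (y S) (y T)"
  have t: "0 < t" "t \<le> y S" "t \<le> y T" using ST by (auto simp: t_def)
  define d :: "'a set \<Rightarrow> real" where
    "d X = of_bool (X = S \<inter> T) + of_bool (X = S \<union> T) - of_bool (X = S) - of_bool (X = T)" for X
  define y' where "y' X = y X + t * d X" for X
  have val_d: "val c d = c (S \<inter> T) + c (S \<union> T) - c S - c T" for c
    unfolding d_def by (simp add: val_plus val_minus val_single IU ST)
  have val_y': "val c y' = val c y + t * (c (S \<inter> T) + c (S \<union> T) - c S - c T)" for c
    unfolding y'_def val_add val_d ..
  have pack: "packing y" using opt by (simp add: optimal_def)
  have "packing y'"
    unfolding packing_def
  proof (intro conjI allI ballI)
    fix X
    have y0: "0 \<le> y X" using pack by (simp add: packing_def)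
    have "S \<noteq> T" "S \<inter> T \<noteq> S" "S \<inter> T \<noteq> T" "S \<union> T \<noteq> S" "S \<union> T \<noteq> T" using cross by blast+
    then consider "X = S" "d X = -1" | "X = T" "d X = -1" | "0 \<le> d X"
      by (cases "X = S"; cases "X = T") (auto simp: d_def)
    then show "0 \<le> y' X"
      unfolding y'_def by cases (use t y0 in auto)
  next
    fix e assume e: "e \<in> E"
    then obtain u v where "e = {u, v}" "u \<noteq> v" by (rule edgeE)
    then have "crosses e (S \<inter> T) + crosses e (S \<union> T) - crosses e S - crosses e T \<le> 0"
      by (auto simp: crosses_doubleton)
    then have "val (crosses e) y' \<le> val (crosses e) y"
      unfolding val_y' using t by (simp add: mult_le_0_iff)
    also have "\<dots> \<le> 1" using pack e by (simp add: packing_def)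
    finally show "val (crosses e) y' \<le> 1" .
  qed
  then have "val (cost \<epsilon>) y' \<le> val (cost \<epsilon>) y" using opt by (simp add: optimal_def)
  then have "cost \<epsilon> (S \<inter> T) + cost \<epsilon> (S \<union> T) - cost \<epsilon> S - cost \<epsilon> T \<le> 0"
    unfolding val_y' using t by (simp add: mult_le_0_iff)
  then have "\<epsilon> * (sz S + sz T) \<le> \<epsilon> * (sz (S \<inter> T) + sz (S \<union> T))"
    by (simp add: cost_def algebra_simps)
  then have "sz S + sz T \<le> sz (S \<inter> T) + sz (S \<union> T)" using \<epsilon> by simp
  moreover have "sz (S \<inter> T) + sz (S \<union> T) < sz S + sz T"
    using ST cross by (intro sz_submodular) (auto simp: cuts_def)
  ultimately show False by simp
qed

text \<open>A cut is represented by each of its two sides; this is the total weight it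
  carries.\<close>

definition both :: "('a set \<Rightarrow> real) \<Rightarrow> 'a set \<Rightarrow> real" where
  "both y S = y S + y (V - S)"

lemma both_compl: "S \<subseteq> V \<Longrightarrow> both y (V - S) = both y S"
  by (simp add: both_def double_diff)

lemma both_nonneg: "packing y \<Longrightarrow> 0 \<le> both y S"
  by (simp add: both_def packing_def)

lemma optimal_both_uncrossed:
  assumes opt: "optimal \<epsilon> y" and \<epsilon>: "0 < \<epsilon>"
    and ST: "S \<in> cuts" "T \<in> cuts" "0 < both y S" "0 < both y T"
  shows "S \<subseteq> T \<or> T \<subseteq> S \<or> S \<inter> T = {} \<or> S \<union> T = V"
proof -
  have ex: "\<exists>X'. (X' = X \<or> X' = V - X) \<and> 0 < y X'" if "0 < both y X" for X
  proof (cases "0 < y X")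
    case False
    then show ?thesis using that by (intro exI[of _ "V - X"]) (simp add: both_def)
  qed blast
  obtain S' where S': "S' = S \<or> S' = V - S" "0 < y S'" using ex[OF ST(3)] by blast
  obtain T' where T': "T' = T \<or> T' = V - T" "0 < y T'" using ex[OF ST(4)] by blast
  have sub: "S \<subseteq> V" "T \<subseteq> V" using ST by (auto simp: cuts_def)
  have "S' \<in> cuts" "T' \<in> cuts" using S'(1) T'(1) ST(1,2) cuts_compl by auto
  note uncrossed = optimal_uncrossed[OF opt \<epsilon> this S'(2) T'(2)]
  show ?thesis
  proof (rule ccontr)
    assume "\<not> ?thesis"
    then obtain a b c d where p: "a \<in> S" "a \<notin> T" "b \<notin> S" "b \<in> T" "c \<in> S" "c \<in> T"
      "d \<notin> S" "d \<notin> T" "d \<in> V" "a \<in> V" "b \<in> V" "c \<in> V"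
      using sub by blast
    have mem: "(\<forall>x\<in>V. x \<in> S' \<longleftrightarrow> x \<in> S) \<or> (\<forall>x\<in>V. x \<in> S' \<longleftrightarrow> x \<notin> S)"
      "(\<forall>x\<in>V. x \<in> T' \<longleftrightarrow> x \<in> T) \<or> (\<forall>x\<in>V. x \<in> T' \<longleftrightarrow> x \<notin> T)"
      using S'(1) T'(1) by auto
    \<comment> \<open>Crossing means that all four corners are nonempty, and complementing either
      set only permutes the corners.\<close>
    have "\<exists>x\<in>V. x \<in> S' \<and> x \<notin> T'" "\<exists>x\<in>V. x \<notin> S' \<and> x \<in> T'" "\<exists>x\<in>V. x \<in> S' \<and> x \<in> T'"
      "\<exists>x\<in>V. x \<notin> S' \<and> x \<notin> T'"
      using mem p by (elim disjE; force)+
    with uncrossed show False by blast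
  qed
qed

text \<open>In a minimal counterexample, weight \<open>t\<close> moves from the cut of
  \<open>S\<close> to each singleton in \<open>S\<close>. Edges leaving \<open>S\<close> gain and
  lose \<open>t\<close>, edges inside \<open>S\<close> have slack, and at least two singletons of
  cost above \<open>1 / 2\<close> outweigh one cut of cost at most 1.\<close>

lemma optimal_ex_singleton:
  assumes opt: "optimal \<epsilon> y" and \<epsilon>: "0 < \<epsilon>" "\<epsilon> * real (card V) < 1 / 2"
    and S: "S \<in> cuts" "2 \<le> card S" "0 < both y S"
  shows "\<exists>v\<in>S. 1 / 2 \<le> both y {v}"
  using S
proof (induction "card S" arbitrary: S rule: less_induct)
  case less
  note S = less.prems
  have pack: "packing y" using opt by (simp add: optimal_def)
  have SV: "S \<subseteq> V" "finite S" using S(1) finite_V by (auto simp: cuts_def intro: finite_subset)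
  show ?case
  proof (rule ccontr)
    assume "\<not> ?thesis"
    then have small: "both y {v} < 1 / 2" if "v \<in> S" for v
      using that by (meson not_le)
    obtain S0 where S0: "S0 = S \<or> S0 = V - S" "0 < y S0"
    proof (cases "0 < y S")
      case False
      then show thesis using S(3) by (intro that[of "V - S"]) (simp_all add: both_def)
    qed (use that in blast)
    have S0_cut: "S0 \<in> cuts" using S0 S(1) cuts_compl by auto
    have single: "{v} \<in> cuts" if "v \<in> S" for v
      using that SV card_V by (auto simp: cuts_def)
    \<comment> \<open>Small enough to keep the weight of \<open>S0\<close> nonnegative and to let an
      edge inside \<open>S\<close> gain \<open>t\<close> at both ends.\<close>
    define t where "t = Min (insert (y S0) ((\<lambda>v. 1 / 2 - both y {v}) ` S))"
    have fin: "finite (insert (y S0) ((\<lambda>v. 1 / 2 - both y {v}) ` S))" using SV by simp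
    have t: "0 < t" "t \<le> y S0" "\<And>v. v \<in> S \<Longrightarrow> t \<le> 1 / 2 - both y {v}"
      unfolding t_def using S0(2) small Min_le[OF fin] by (auto simp: Min_gr_iff[OF fin])
    define d :: "'a set \<Rightarrow> real" where
      "d X = (\<Sum>v\<in>S. of_bool (X = {v})) - of_bool (X = S0)" for X
    define y' where "y' X = y X + t * d X" for X
    have "val c (\<lambda>X. \<Sum>v\<in>S. of_bool (X = {v})) = (\<Sum>v\<in>S. c {v})" for c
    proof -
      have "val c (\<lambda>X. \<Sum>v\<in>S. of_bool (X = {v})) = (\<Sum>v\<in>S. val c (\<lambda>X. of_bool (X = {v})))"
        unfolding val_def sum_distrib_left by (rule sum.swap)
      then show ?thesis by (simp add: val_single single)
    qed
    then have val_y': "val c y' = val c y + t * ((\<Sum>v\<in>S. c {v}) - c S0)" for c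
      unfolding y'_def d_def val_add by (simp add: val_minus val_single S0_cut)
    \<comment> \<open>Weighted cuts separating \<open>u\<close> from \<open>v\<close> do not cross
      \<open>S\<close>, so one side lies properly inside \<open>S\<close> and, by induction, is a
      singleton.\<close>
    have inside: "val (crosses {u, v}) y \<le> both y {u} + both y {v}"
      if uv: "u \<in> S" "v \<in> S" "u \<noteq> v" for u v
    proof -
      let ?U = "{{u}, V - {u}, {v}, V - {v}}"
      have "X \<in> ?U" if X: "X \<in> cuts" "crosses {u, v} X * y X \<noteq> 0" for X
      proof -
        have sep: "(u \<in> X) \<noteq> (v \<in> X)" and "y X \<noteq> 0"
          using X(2) uv by (auto simp: crosses_doubleton)
        then have "0 < y X" "0 \<le> y (V - X)"
          using pack by (auto simp: packing_def less_le)
        then have bX: "0 < both y X" "0 < both y (V - X)"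
          using X(1) by (auto simp: both_def double_diff cuts_def)
        have small_card: "card Y < 2" if "Y \<in> cuts" "Y \<subset> S" "0 < both y Y" for Y
          using less.hyps[of Y] psubset_card_mono[OF SV(2) that(2)] that small by force
        have one: "Y = {u} \<or> Y = {v}" if Y: "Y \<in> cuts" "Y \<subset> S" "0 < both y Y" "(u \<in> Y) \<noteq> (v \<in> Y)" for Y
        proof -
          have "finite Y" "Y \<noteq> {}" using Y(1) finite_V by (auto simp: cuts_def intro: finite_subset)
          then have "card Y = 1" using small_card[OF Y(1-3)] card_gt_0_iff[of Y] by simp
          then show ?thesis using Y(4) by (auto simp: card_1_singleton_iff)
        qed
        have "X \<subseteq> S \<or> X \<union> S = V"
          using optimal_both_uncrossed[OF opt \<epsilon>(1) X(1) S(1) bX(1) S(3)] sep uv by blast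
        then show ?thesis
        proof
          assume "X \<subseteq> S"
          then have "X \<subset> S" using sep uv by blast
          from one[OF X(1) this bX(1) sep] show ?thesis by blast
        next
          assume "X \<union> S = V"
          have XV: "X \<subseteq> V" using X(1) by (auto simp: cuts_def)
          have sep': "(u \<in> V - X) \<noteq> (v \<in> V - X)" using sep uv SV(1) by blast
          then have "V - X \<subset> S" using \<open>X \<union> S = V\<close> uv by blast
          from one[OF cuts_compl[OF X(1)] this bX(2) sep'] have "V - X = {u} \<or> V - X = {v}" .
          moreover have "X = V - (V - X)" using XV by blast
          ultimately show ?thesis by auto
        qed
      qed
      then have "val (crosses {u, v}) y = (\<Sum>X\<in>cuts \<inter> ?U. crosses {u, v} X * y X)"
        unfolding val_def using finite_cuts by (intro sum.mono_neutral_right) auto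
      also have "\<dots> \<le> (\<Sum>X\<in>cuts \<inter> ?U. y X)"
        using pack by (intro sum_mono) (auto simp: crosses_def packing_def)
      also have "\<dots> \<le> (\<Sum>X\<in>?U. y X)"
        using pack by (intro sum_mono2) (auto simp: packing_def)
      also have "\<dots> \<le> both y {u} + both y {v}"
        using pack by (simp add: both_def sum.insert_if packing_def)
      finally show ?thesis .
    qed
    have "packing y'"
      unfolding packing_def
    proof (intro conjI allI ballI)
      fix X
      have y0: "0 \<le> y X" using pack by (simp add: packing_def)
      have "0 \<le> t * (\<Sum>v\<in>S. of_bool (X = {v}))" using t by (simp add: sum_nonneg)
      moreover have "0 \<le> y X - t * of_bool (X = S0)" using t y0 by auto
      ultimately show "0 \<le> y' X" by (simp add: y'_def d_def algebra_simps)
    next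
      fix e assume e: "e \<in> E"
      then obtain u v where uv: "e = {u, v}" "u \<noteq> v" "u \<in> V" "v \<in> V" by (rule edgeE)
      have ends: "(\<Sum>x\<in>S. crosses e {x}) = of_bool (u \<in> S) + of_bool (v \<in> S)"
      proof -
        have "(\<Sum>x\<in>S. crosses e {x}) = (\<Sum>x\<in>S. of_bool (x = u \<or> x = v) * 1)"
          using uv by (intro sum.cong) (auto simp: crosses_doubleton)
        also have "\<dots> = of_bool (u \<in> S) + of_bool (v \<in> S)"
          using sum_of_bool_mem[OF SV(2) uv(2), of "\<lambda>_. 1"] by simp
        finally show ?thesis .
      qed
      have "crosses e S0 = crosses e S" using S0(1) crosses_compl[OF e] by auto
      then have S0e: "crosses e S0 = of_bool ((u \<in> S) \<noteq> (v \<in> S))"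
        using uv by (simp add: crosses_doubleton)
      have le1: "val (crosses e) y \<le> 1" using pack e by (simp add: packing_def)
      show "val (crosses e) y' \<le> 1"
      proof (cases "u \<in> S \<and> v \<in> S")
        case True
        then have "val (crosses e) y' = val (crosses e) y + 2 * t"
          by (simp add: val_y' ends S0e)
        also have "\<dots> \<le> 1"
          using inside[of u v] t(3)[of u] t(3)[of v] True uv by simp
        finally show ?thesis .
      next
        case False
        then have "val (crosses e) y' = val (crosses e) y"
          by (auto simp: val_y' ends S0e)
        with le1 show ?thesis by simp
      qed
    qed
    then have "val (cost \<epsilon>) y' \<le> val (cost \<epsilon>) y" using opt by (simp add: optimal_def)
    then have "(\<Sum>v\<in>S. cost \<epsilon> {v}) \<le> cost \<epsilon> S0"
      unfolding val_y' using t by (simp add: mult_le_0_iff)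
    also have "\<dots> \<le> 1"
      using \<epsilon> sz_nonneg[of S0] S0_cut by (auto simp: cost_def cuts_def)
    finally have "(\<Sum>v\<in>S. cost \<epsilon> {v}) \<le> 1" .
    moreover have "1 / 2 < cost \<epsilon> {v}" for v
      using \<epsilon> by (simp add: cost_def sz_def algebra_simps)
    then have "(\<Sum>v\<in>S. 1 / 2) < (\<Sum>v\<in>S. cost \<epsilon> {v})"
      using SV S(2) by (intro sum_strict_mono) auto
    ultimately show False using S(2) by simp
  qed
qed

text \<open>Taking the side that avoids \<open>\<rho>\<close> selects one representative of every
  cut.\<close>

lemma sum_both:
  assumes \<rho>: "\<rho> \<in> V" and sym: "\<And>S. S \<in> cuts \<Longrightarrow> c (V - S) = c S"
  shows "(\<Sum>S\<in>{S \<in> cuts. \<rho> \<notin> S}. c S * both y S) = val c y"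
proof -
  let ?A = "{S \<in> cuts. \<rho> \<notin> S}" and ?B = "{S \<in> cuts. \<rho> \<in> S}"
  have "(\<Sum>S\<in>?A. c S * y (V - S)) = (\<Sum>S\<in>?B. c S * y S)"
    by (rule sum.reindex_bij_witness[of _ "\<lambda>S. V - S" "\<lambda>S. V - S"])
       (use \<rho> sym in \<open>auto simp: cuts_def\<close>)
  moreover have "val c y = (\<Sum>S\<in>?A. c S * y S) + (\<Sum>S\<in>?B. c S * y S)"
    unfolding val_def using finite_cuts
    by (subst sum.union_disjoint[symmetric]) (auto intro!: sum.cong)
  ultimately show ?thesis
    by (simp add: both_def distrib_left sum.distrib)
qed

text \<open>Half a unit of every singleton cut is traded for the radius \<open>z v\<close>; the singleton cut of the root
  \<open>\<rho>\<close> is represented by \<open>V - {\<rho>}\<close>.\<close>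

lemma optimal_bound:
  assumes opt: "optimal \<epsilon> y" and \<epsilon>: "0 < \<epsilon>" "\<epsilon> * real (card V) < 1 / 2"
    and tough: "\<And>X. X \<subseteq> V \<Longrightarrow> comps_after_deleting V E X > 1 \<Longrightarrow>
      8 * real (comps_after_deleting V E X) \<le> real (card X)"
  shows "2 * val (\<lambda>_. 1) y \<le> real (card V)"
proof (cases "\<exists>X\<in>cuts. 0 < y X")
  case False
  have "val (\<lambda>_. 1) y \<le> 0"
    unfolding val_def by (rule sum_nonpos) (use False in force)
  then show ?thesis by simp
next
  case True
  have pack: "packing y" using opt by (simp add: optimal_def)
  obtain X where X: "X \<in> cuts" "0 < y X" using True by blast
  \<comment> \<open>If the weighted side is a singleton, its complement has at least two elements
    because \<open>V\<close> has at least three.\<close>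
  obtain S where S: "S \<in> cuts" "2 \<le> card S" "0 < both y S"
  proof (cases "2 \<le> card X")
    case True
    moreover have "0 \<le> y (V - X)" using pack by (simp add: packing_def)
    ultimately show thesis using X that[of X] by (simp add: both_def)
  next
    case False
    have "X \<subseteq> V" using X by (auto simp: cuts_def)
    then have "card (V - X) = card V - card X"
      using finite_V by (intro card_Diff_subset) (auto intro: finite_subset)
    moreover have "0 < both y (V - X)"
      using X(2) \<open>X \<subseteq> V\<close> pack by (simp add: both_compl) (simp add: both_def packing_def add_pos_nonneg)
    ultimately show thesis using that[of "V - X"] cuts_compl[OF X(1)] False card_V by simp
  qed
  obtain \<rho> where \<rho>S: "\<rho> \<in> S" "1 / 2 \<le> both y {\<rho>}"
    using optimal_ex_singleton[OF opt \<epsilon> S] by blast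
  have \<rho>: "\<rho> \<in> V" using \<rho>S S(1) by (auto simp: cuts_def)
  let ?R = "{S \<in> cuts. \<rho> \<notin> S}"
  \<comment> \<open>\<open>p v\<close> is the weight taken off the singleton cut of
    \<open>v\<close>. The cap \<open>1 / 2\<close> makes \<open>z v\<close> vanish exactly when that
    cut carries at least \<open>1 / 2\<close>.\<close>
  define p where "p v = min (both y {v}) (1 / 2)" for v
  define base where "base v = (if v = \<rho> then V - {\<rho>} else {v})" for v
  define w where "w S = both y S - (\<Sum>v\<in>V. of_bool (S = base v) * p v)" for S
  define z where "z v = 1 / 2 - p v" for v
  define L where "L = {S \<in> ?R. 0 < w S}"
  have p0: "0 \<le> p v" for v
    using both_nonneg[OF pack] by (simp add: p_def)
  have single: "{v} \<in> cuts" if "v \<in> V" for v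
    using that card_V by (auto simp: cuts_def)
  have base_R: "base v \<in> ?R" if "v \<in> V" for v
    using single[OF that] cuts_compl[OF single[OF \<rho>]] by (simp add: base_def)
  have big: "card (V - {\<rho>}) \<ge> 2"
    using card_V \<rho> finite_V by simp
  have base_inj: "u = v" if "base u = base v" "u \<in> V" "v \<in> V" for u v
  proof -
    have "V - {\<rho>} \<noteq> {x}" for x
    proof
      assume "V - {\<rho>} = {x}"
      then have "card (V - {\<rho>}) = 1" by simp
      with big show False by simp
    qed
    then show ?thesis using that(1) unfolding base_def by (metis singleton_inject)
  qed
  have both_base: "both y (base v) = both y {v}" if "v \<in> V" for v
    using that \<rho> by (simp add: base_def both_compl)
  have w_base: "w (base v) = both y {v} - p v" if "v \<in> V" for v
  proof -
    have "(\<Sum>x\<in>V. of_bool (base v = base x) * p x) = (\<Sum>x\<in>V. if x = v then p v else 0)"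
      using that base_inj by (intro sum.cong) auto
    then show ?thesis using that finite_V by (simp add: w_def both_base)
  qed
  have w_other: "w S = both y S" if "\<And>v. v \<in> V \<Longrightarrow> S \<noteq> base v" for S
    using that unfolding w_def by (simp add: sum.neutral)
  have w_nonneg: "0 \<le> w S" for S
  proof (cases "\<exists>v\<in>V. S = base v")
    case True
    then show ?thesis by (auto simp: w_base p_def)
  next
    case False
    then have "w S = both y S" by (intro w_other) auto
    then show ?thesis using both_nonneg[OF pack] by simp
  qed
  have w_le: "w S \<le> both y S" for S
    unfolding w_def using p0 by (simp add: sum_nonneg)
  have sum_w: "(\<Sum>S\<in>?R. c S * w S) = val c y - (\<Sum>v\<in>V. c (base v) * p v)"
    if sym: "\<And>S. S \<in> cuts \<Longrightarrow> c (V - S) = c S" for c :: "'a set \<Rightarrow> real"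
  proof -
    have "(\<Sum>S\<in>?R. c S * (\<Sum>v\<in>V. of_bool (S = base v) * p v)) =
        (\<Sum>v\<in>V. \<Sum>S\<in>?R. c S * (of_bool (S = base v) * p v))"
      unfolding sum_distrib_left by (rule sum.swap)
    also have "\<dots> = (\<Sum>v\<in>V. \<Sum>S\<in>?R. if S = base v then c (base v) * p v else 0)"
      by (intro sum.cong) auto
    also have "\<dots> = (\<Sum>v\<in>V. c (base v) * p v)"
      using finite_cuts base_R by (intro sum.cong) auto
    finally have *: "(\<Sum>S\<in>?R. c S * (\<Sum>v\<in>V. of_bool (S = base v) * p v)) = (\<Sum>v\<in>V. c (base v) * p v)" .
    show ?thesis
      unfolding w_def right_diff_distrib sum_subtractf * using sum_both[of \<rho> c y] \<rho> sym by simp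
  qed
  have sum_L: "(\<Sum>S\<in>?R. c S * w S) = (\<Sum>S\<in>L. c S * w S)" for c :: "'a set \<Rightarrow> real"
    unfolding L_def using finite_cuts w_nonneg
    by (intro sum.mono_neutral_right) (auto simp: less_le)
  have finite_L: "finite L" using finite_cuts by (simp add: L_def)
  interpret rooted_laminar V E \<rho> L w z
  proof
    show "finite V" "\<rho> \<in> V" by (rule finite_V \<rho>)+
    show "z \<rho> = 0" using \<rho>S(2) by (simp add: z_def p_def)
    show "finite L" by (rule finite_L)
    show "0 \<le> z v" for v by (simp add: z_def p_def)
  next
    fix S assume S: "S \<in> L"
    then have SR: "S \<in> cuts" "\<rho> \<notin> S" "0 < w S" by (auto simp: L_def)
    then show "S \<subseteq> V - {\<rho>}" "0 \<le> w S" by (auto simp: cuts_def)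
    have "\<exists>x\<in>S. 1 / 2 \<le> both y {x}"
    proof (cases "2 \<le> card S")
      case True
      then show ?thesis
        using optimal_ex_singleton[OF opt \<epsilon> SR(1) True] w_le[of S] SR(3) by simp
    next
      case False
      have "finite S" "S \<noteq> {}" using SR(1) finite_V by (auto simp: cuts_def intro: finite_subset)
      then have "card S = 1" using False card_gt_0_iff[of S] by linarith
      then obtain x where x: "S = {x}" by (auto simp: card_1_singleton_iff)
      then have "x \<in> V" "S = base x" using SR by (auto simp: cuts_def base_def)
      \<comment> \<open>A singleton that keeps positive weight has reached the cap.\<close>
      then have "0 < both y {x} - p x" using SR(3) w_base by simp
      then show ?thesis using x by (auto simp: p_def min_def split: if_splits)
    qed
    then obtain x where "x \<in> S" "1 / 2 \<le> both y {x}" by blast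
    then show "\<exists>x\<in>S. z x = 0" by (intro bexI[of _ x]) (simp_all add: z_def p_def)
  next
    fix S T assume "S \<in> L" "T \<in> L"
    then have ST: "S \<in> cuts" "T \<in> cuts" "0 < both y S" "0 < both y T" "\<rho> \<notin> S" "\<rho> \<notin> T"
      using w_le[of S] w_le[of T] by (auto simp: L_def)
    have "S \<union> T \<noteq> V" using ST(5,6) \<rho> by blast
    with optimal_both_uncrossed[OF opt \<epsilon>(1) ST(1-4)]
    show "S \<subseteq> T \<or> T \<subseteq> S \<or> S \<inter> T = {}" by blast
  next
    fix u v assume e: "{u, v} \<in> E"
    then have uv: "u \<noteq> v" "u \<in> V" "v \<in> V"
      by (auto elim!: edgeE simp: doubleton_eq_iff)
    let ?c = "crosses {u, v}"
    have "sum w {T \<in> L. (u \<in> T) \<noteq> (v \<in> T)} = (\<Sum>T\<in>L. ?c T * w T)"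
      using finite_L uv(1)
      by (intro sum.mono_neutral_cong_left) (auto simp: crosses_doubleton)
    also have "\<dots> = val ?c y - (\<Sum>x\<in>V. ?c (base x) * p x)"
      unfolding sum_L[symmetric] by (rule sum_w) (simp add: crosses_compl[OF e])
    also have "(\<Sum>x\<in>V. ?c (base x) * p x) = (\<Sum>x\<in>V. of_bool (x = u \<or> x = v) * p x)"
    proof (intro sum.cong refl)
      fix x assume "x \<in> V"
      have "?c (base x) = ?c {x}"
        using crosses_compl[OF e, of "{x}"] by (cases "x = \<rho>") (simp_all add: base_def)
      then show "?c (base x) * p x = of_bool (x = u \<or> x = v) * p x"
        using uv(1) by (auto simp: crosses_doubleton)
    qed
    also have "\<dots> = p u + p v"
      using sum_of_bool_mem[OF finite_V uv(1)] uv by simp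
    also have "val ?c y - (p u + p v) \<le> z u + z v"
      using pack e by (auto simp: packing_def z_def)
    finally show "sum w {T \<in> L. (u \<in> T) \<noteq> (v \<in> T)} \<le> z u + z v" .
  qed
  \<comment> \<open>The traded weight \<open>sum p V\<close> is missing from both the tree length
    and the sum of radii, so it cancels.\<close>
  have "val (\<lambda>_. 1) y - sum p V = sum w L"
    using sum_w[of "\<lambda>_. 1"] sum_L[of "\<lambda>_. 1"] by simp
  also have "\<dots> \<le> sum z V"
    by (rule sum_weights_le[OF graph tough])
  also have "\<dots> = real (card V) / 2 - sum p V"
    by (simp add: z_def sum_subtractf)
  finally show ?thesis by simp
qed

text \<open>A violation by a positive gap survives a small enough penalty, and would then also occur
  at an optimum of the penalised problem.\<close>

lemma packing_bound:
  assumes y: "packing y"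
    and tough: "\<And>X. X \<subseteq> V \<Longrightarrow> comps_after_deleting V E X > 1 \<Longrightarrow>
      8 * real (comps_after_deleting V E X) \<le> real (card X)"
  shows "2 * val (\<lambda>_. 1) y \<le> real (card V)"
proof (rule ccontr)
  assume neg: "\<not> ?thesis"
  define n gap m where "n = real (card V)" and "gap = val (\<lambda>_. 1) y - n / 2" and "m = val sz y"
  have gap: "0 < gap" and n: "0 < n" using neg card_V by (auto simp: n_def gap_def)
  have m: "0 \<le> m"
    unfolding m_def val_def using y sz_nonneg
    by (intro sum_nonneg) (auto simp: packing_def cuts_def)
  \<comment> \<open>The first term meets the hypothesis of \<open>optimal_bound\<close>; the second
    keeps the penalty of \<open>y\<close> below the gap, with \<open>m + 1\<close> guarding against
    a zero denominator.\<close>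
  define \<epsilon> where "\<epsilon> = min (1 / (4 * n)) (gap / (2 * (m + 1)))"
  have \<epsilon>: "0 < \<epsilon>" using gap n m by (simp add: \<epsilon>_def)
  have "\<epsilon> * n \<le> 1 / (4 * n) * n"
    using n by (intro mult_right_mono) (auto simp: \<epsilon>_def)
  then have \<epsilon>n: "\<epsilon> * real (card V) < 1 / 2" using n by (simp add: n_def)
  have "\<epsilon> * m \<le> gap / (2 * (m + 1)) * m"
    using m by (intro mult_right_mono) (auto simp: \<epsilon>_def)
  also have "\<dots> < gap"
    using m gap by (simp add: field_simps add_nonneg_pos)
  finally have \<epsilon>m: "\<epsilon> * m < gap" .
  obtain y' where y': "optimal \<epsilon> y'"
    using ex_max_packing[of "cost \<epsilon>"] unfolding optimal_def by blast
  have "val (cost \<epsilon>) y = val (\<lambda>_. 1) y - \<epsilon> * m"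
    by (simp add: val_def cost_def m_def sum_subtractf sum_distrib_left algebra_simps)
  moreover have "val (cost \<epsilon>) y \<le> val (cost \<epsilon>) y'"
    using y y' by (simp add: optimal_def)
  moreover have "val (cost \<epsilon>) y' \<le> val (\<lambda>_. 1) y'"
    using y' \<epsilon> sz_nonneg
    by (intro val_mono mult_right_mono) (auto simp: cost_def cuts_def optimal_def packing_def)
  ultimately have "n < 2 * val (\<lambda>_. 1) y'"
    using \<epsilon>m by (simp add: gap_def)
  with optimal_bound[OF y' \<epsilon> \<epsilon>n tough] show False
    by (simp add: n_def)
qed

section \<open>Linear programming duality\<close>

text \<open>If no such \<open>f\<close> exists, Farkas' lemma gives multipliers \<open>y\<close> of
  the cut constraints and \<open>t\<close> of the constraint on the total. Dividing \<open>y\<close>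
  by \<open>t\<close> produces a packing that violates the bound.\<close>

lemma ex_fractional_cut_cover:
  assumes bound: "\<And>y. packing y \<Longrightarrow> 2 * val (\<lambda>_. 1) y \<le> real (card V)"
  shows "\<exists>f. (\<forall>e\<in>E. 0 \<le> f e) \<and> (\<forall>S\<in>cuts. 2 \<le> (\<Sum>e\<in>E. crosses e S * f e)) \<and> sum f E \<le> real (card V)"
proof (rule ccontr)
  assume infeasible: "\<not> ?thesis"
  define C where "C = (\<lambda>e. (\<lambda>e'. of_bool (e' = e), 0 :: real)) ` E \<union>
    (\<lambda>S. (\<lambda>e. crosses e S, 2)) ` cuts \<union> {(\<lambda>_. - 1, - real (card V))}"
  have finE: "finite E" by (rule finite_edges[OF graph])
  have "\<exists>(a, b)\<in>C. (\<Sum>e\<in>E. a e * f e) < b" for f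
  proof (rule ccontr)
    assume "\<not> ?thesis"
    then have feas: "b \<le> (\<Sum>e\<in>E. a e * f e)" if "(a, b) \<in> C" for a b
      using that by force
    have "0 \<le> f e" if "e \<in> E" for e
    proof -
      have "0 \<le> (\<Sum>e'\<in>E. of_bool (e' = e) * f e')"
        using that by (intro feas) (auto simp: C_def)
      also have "\<dots> = (\<Sum>e'\<in>E. if e' = e then f e else 0)" by (intro sum.cong) auto
      also have "\<dots> = f e" using finE that by simp
      finally show ?thesis .
    qed
    moreover have "2 \<le> (\<Sum>e\<in>E. crosses e S * f e)" if "S \<in> cuts" for S
      using that by (intro feas) (auto simp: C_def)
    moreover have "- real (card V) \<le> (\<Sum>e\<in>E. - 1 * f e)"
      by (intro feas) (auto simp: C_def)
    then have "sum f E \<le> real (card V)" by (simp add: sum_negf)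
    ultimately show False using infeasible by blast
  qed
  then obtain a b where ab: "(a, b) \<in> conic_hull_pairs C" "\<forall>e\<in>E. a e = 0" "0 < b"
    using farkas[OF finE, of C] finE finite_cuts by (auto simp: C_def)
  \<comment> \<open>The multipliers of the constraints \<open>0 \<le> f e\<close> are left implicit,
    which is why the coefficients satisfy only an inequality.\<close>
  have "\<exists>y t. (\<forall>S. 0 \<le> y S) \<and> 0 \<le> t \<and> (\<forall>e\<in>E. val (crosses e) y - t \<le> fst c e) \<and>
      snd c = 2 * val (\<lambda>_. 1) y - t * real (card V)" if "c \<in> conic_hull_pairs C" for c
    using that
  proof induction
    case (conic_base c)
    then consider e where "c = (\<lambda>e'. of_bool (e' = e), 0)" |
      S where "S \<in> cuts" "c = (\<lambda>e. crosses e S, 2)" | "c = (\<lambda>_. - 1, - real (card V))"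
      by (auto simp: C_def)
    then show ?case
    proof cases
      case 1
      then show ?thesis by (intro exI[of _ "\<lambda>_. 0"] exI[of _ 0]) (auto simp: val_def)
    next
      case (2 S)
      then show ?thesis
        by (intro exI[of _ "\<lambda>X. of_bool (X = S)"] exI[of _ 0]) (auto simp: val_single)
    next
      case 3
      then show ?thesis by (intro exI[of _ "\<lambda>_. 0"] exI[of _ 1]) (auto simp: val_def)
    qed
  next
    case (conic_add a b a' b')
    obtain y t where y: "\<forall>S. 0 \<le> y S" "0 \<le> t" "\<forall>e\<in>E. val (crosses e) y - t \<le> a e"
      "b = 2 * val (\<lambda>_. 1) y - t * real (card V)"
      using conic_add.IH(1) by auto
    obtain y' t' where y': "\<forall>S. 0 \<le> y' S" "0 \<le> t'" "\<forall>e\<in>E. val (crosses e) y' - t' \<le> a' e"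
      "b' = 2 * val (\<lambda>_. 1) y' - t' * real (card V)"
      using conic_add.IH(2) by auto
    show ?case
      using y y'
      by (intro exI[of _ "\<lambda>S. y S + y' S"] exI[of _ "t + t'"])
         (auto simp: val_plus algebra_simps dest!: bspec intro: add_mono)
  next
    case (conic_scale a b s)
    obtain y t where y: "\<forall>S. 0 \<le> y S" "0 \<le> t" "\<forall>e\<in>E. val (crosses e) y - t \<le> a e"
      "b = 2 * val (\<lambda>_. 1) y - t * real (card V)"
      using conic_scale.IH by auto
    have "s * (val (crosses e) y - t) \<le> s * a e" if "e \<in> E" for e
      using y(3) conic_scale.hyps that by (intro mult_left_mono) auto
    moreover have "val c (\<lambda>S. s * y S) = s * val c y" for c
      by (simp add: val_def sum_distrib_left algebra_simps)
    ultimately show ?case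
      using y(1-3) conic_scale.hyps
      by (intro exI[of _ "\<lambda>S. s * y S"] exI[of _ "s * t"]) (auto simp: y(4) algebra_simps)
  qed
  from this[OF ab(1)] obtain y t where y: "\<And>S. 0 \<le> y S" and t: "0 \<le> t"
    and le: "\<And>e. e \<in> E \<Longrightarrow> val (crosses e) y \<le> t"
    and pos: "t * real (card V) < 2 * val (\<lambda>_. 1) y"
    using ab(2,3) by fastforce
  \<comment> \<open>With \<open>t = 0\<close> no edge could carry any load, and since every cut is
    crossed by an edge, \<open>y\<close> would vanish on \<open>cuts\<close>.\<close>
  have "t \<noteq> 0"
  proof
    assume t0: "t = 0"
    have "y S = 0" if S: "S \<in> cuts" for S
    proof -
      obtain e where e: "e \<in> E" "crosses e S = 1"
        using ex_crossing_edge[OF S] by blast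
      have "crosses e S * y S \<le> val (crosses e) y"
        unfolding val_def using y finite_cuts S
        by (intro member_le_sum) (auto simp: crosses_nonneg)
      then show ?thesis using le[OF e(1)] e(2) t0 y[of S] by simp
    qed
    then have "val (\<lambda>_. 1) y = 0" by (simp add: val_def)
    with pos t0 show False by simp
  qed
  with t have t: "0 < t" by simp
  have scale: "val c (\<lambda>S. y S / t) = val c y / t" for c
    by (simp add: val_def sum_divide_distrib)
  have "packing (\<lambda>S. y S / t)"
    using y le t by (simp add: packing_def scale)
  from bound[OF this] show False
    using pos t by (simp add: scale field_simps)
qed

section \<open>From cut covers to fractional Hamiltonian cycles\<close>

lemma sum_edge_cut: "sum f (edge_cut E S) = (\<Sum>e\<in>E. crosses e S * f e)"
  unfolding edge_cut_def crosses_def using finite_edges[OF graph]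
  by (intro sum.mono_neutral_cong_left) auto

text \<open>The degrees \<open>D v\<close> are at least 2 and sum to twice the total weight, so all
  of them equal 2 and the total is exact. For an edge with ends \<open>u\<close> and
  \<open>v\<close>, the cut of \<open>{u, v}\<close> has weight \<open>4 - 2 * f e\<close>, which
  must be at least 2.\<close>

lemma fractionally_Hamiltonian_if_cover:
  assumes f0: "\<And>e. e \<in> E \<Longrightarrow> 0 \<le> f e"
    and cut: "\<And>S. S \<in> cuts \<Longrightarrow> 2 \<le> (\<Sum>e\<in>E. crosses e S * f e)"
    and total: "sum f E \<le> real (card V)"
  shows "fractional_Hamiltonian_cycle V E f"
proof -
  define D where "D v = (\<Sum>e\<in>E. crosses e {v} * f e)" for v
  have single: "{v} \<in> cuts" if "v \<in> V" for v
    using that card_V by (auto simp: cuts_def)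
  have ends: "(\<Sum>v\<in>V. crosses e {v}) = 2" if e: "e \<in> E" for e
  proof -
    obtain u v where uv: "e = {u, v}" "u \<noteq> v" "u \<in> V" "v \<in> V" by (rule edgeE[OF e])
    have "(\<Sum>x\<in>V. crosses e {x}) = (\<Sum>x\<in>V. of_bool (x = u \<or> x = v) * 1)"
      using uv by (intro sum.cong) (auto simp: crosses_doubleton)
    then show ?thesis
      using sum_of_bool_mem[OF finite_V uv(2), of "\<lambda>_. 1"] uv by simp
  qed
  have "sum D V = (\<Sum>e\<in>E. \<Sum>v\<in>V. crosses e {v} * f e)"
    unfolding D_def by (rule sum.swap)
  also have "\<dots> = 2 * sum f E"
    unfolding sum_distrib_right[symmetric] sum_distrib_left by (intro sum.cong) (auto simp: ends)
  finally have sum_D: "sum D V = 2 * sum f E" .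
  have D2: "2 \<le> D v" if "v \<in> V" for v
    unfolding D_def by (rule cut[OF single[OF that]])
  have "(\<Sum>v\<in>V. D v - 2) \<le> 0"
    using sum_D total by (simp add: sum_subtractf)
  then have "(\<Sum>v\<in>V. D v - 2) = 0"
    using D2 by (intro antisym sum_nonneg) auto
  then have D_eq: "D v = 2" if "v \<in> V" for v
    using D2 that finite_V by (subst (asm) sum_nonneg_eq_0_iff) auto
  have "sum f E = real (card V)"
    using sum_D D_eq by simp
  moreover have "f e \<le> 1" if e: "e \<in> E" for e
  proof -
    obtain u v where uv: "e = {u, v}" "u \<noteq> v" "u \<in> V" "v \<in> V" by (rule edgeE[OF e])
    \<comment> \<open>Three vertices are needed for the ends of an edge to form a proper
      subset.\<close>
    have "{u, v} \<in> cuts"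
    proof -
      have "card {u, v} < card V" using card_V uv(2) by simp
      then have "{u, v} \<noteq> V" by blast
      then show ?thesis using uv(3,4) by (simp add: cuts_def psubset_eq)
    qed
    from cut[OF this] have "2 \<le> (\<Sum>e'\<in>E. crosses e' {u, v} * f e')" .
    also have "\<dots> = (\<Sum>e'\<in>E. crosses e' {u} * f e' + crosses e' {v} * f e' - 2 * (if e' = e then f e else 0))"
    proof (intro sum.cong refl)
      fix e' assume "e' \<in> E"
      then obtain a b where ab: "e' = {a, b}" "a \<noteq> b" by (rule edgeE)
      have *: "crosses e' {u, v} = crosses e' {u} + crosses e' {v} - 2 * of_bool (e' = e)"
        unfolding ab(1) uv(1) crosses_doubleton[OF ab(2)] doubleton_eq_iff
        using ab(2) uv(2) by (cases "a = u"; cases "a = v"; cases "b = u"; cases "b = v") simp_all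
      show "crosses e' {u, v} * f e' =
          crosses e' {u} * f e' + crosses e' {v} * f e' - 2 * (if e' = e then f e else 0)"
        unfolding * by (cases "e' = e") (simp_all add: algebra_simps)
    qed
    also have "\<dots> = D u + D v - 2 * f e"
      using finite_edges[OF graph] e
      by (simp add: sum_subtractf sum.distrib D_def sum_distrib_left[symmetric])
    finally show ?thesis using D_eq uv by simp
  qed
  ultimately show ?thesis
    using f0 cut by (simp add: fractional_Hamiltonian_cycle_def sum_edge_cut cuts_def)
qed

end

theorem theorem2:
  fixes V :: "'a set" and E :: "'a set set"
  assumes "fin_simple_graph V E"
    and "connected_graph V E"
    and "card V \<ge> 3"
    and "tough 10 V E"
  shows "fractionally_Hamiltonian V E"
proof -
  interpret connected_graph_3 V E
    using assms(1-3) by unfold_locales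
  have "8 * real (comps_after_deleting V E X) \<le> real (card X)"
    if "X \<subseteq> V" "comps_after_deleting V E X > 1" for X
    using tough_bound[OF assms(1,4) that] by simp
  from ex_fractional_cut_cover[OF packing_bound[OF _ this]]
  obtain f where "fractional_Hamiltonian_cycle V E f"
    using fractionally_Hamiltonian_if_cover by blast
  then show ?thesis
    by (auto simp: fractionally_Hamiltonian_def)
qed

end
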